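(* Let $s\geq 3$ be a fixed integer, and let $\gamma=1$ if $s=3$ and $\gamma=0$ if $s\geq 4$. Let $w_1,w_2,\ldots$ be a sequence of real numbers such that $w_n\to\infty$ as $n\to\infty$, and let $p=p(n)\in(0,1]$. Then, whp, $$\mathrm{wsat}\big(\mathbb{G}(n,p),K_s\big)\leq (s-2)n+\frac{w_n(\ln n)^{2(\gamma+s-2)}}{p^{2s-3}}.$$
   Context: All graphs are finite and simple. $K_s$ is the complete graph on $s$ vertices. Given a graph $F$, an $F$-bootstrap percolation process is a sequence of graphs $H_0\subset H_1\subset\cdots\subset H_m$ (on the same vertex set) such that, for $i=1,\ldots,m$, $H_i$ is obtained from $H_{i-1}$ by adding an edge that belongs to a copy of $F$ in $H_i$. Given graphs $G$ and $F$, a spanning subgraph $H$ of $G$ is a weakly $F$-saturated subgraph of $G$ if $H$ contains no subgraph isomorphic to $F$ and there is an $F$-bootstrap percolation process $H=H_0\subset H_1\subset\cdots\subset H_m=G$. The minimum number of edges in a weakly $F$-saturated subgraph of $G$ is denoted by $\mathrm{wsat}(G,F)$. $\mathbb{G}(n,p)$ is the Erdős–Rényi random graph on vertex set $\{1,\ldots,n\}$ in which each pair of distinct vertices is an edge with probability $p$ independently of all others. "Whp" (with high probability) means with probability tending to $1$ as $n\to\infty$. *)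

theory Defs
  imports "HOL-Probability.Probability"
begin

text \<open>
  A finite simple graph is a pair of a finite vertex set and a set of edges, each edge being a
  two-element set of vertices.
\<close>

type_synonym 'a graph = "'a set \<times> 'a set set"

abbreviation verts :: "'a graph \<Rightarrow> 'a set" where "verts \<equiv> fst"
abbreviation edges :: "'a graph \<Rightarrow> 'a set set" where "edges \<equiv> snd"

definition all_pairs :: "'a set \<Rightarrow> 'a set set" where
  "all_pairs V = {e. e \<subseteq> V \<and> card e = 2}"

definition simple_graph :: "'a graph \<Rightarrow> bool" where
  "simple_graph G \<longleftrightarrow> finite (verts G) \<and> edges G \<subseteq> all_pairs (verts G)"

definition complete_simple_graph :: "nat \<Rightarrow> nat graph" where
  "complete_simple_graph s = ({1..s}, all_pairs {1..s})"

definition spanning_subgraph :: "'a graph \<Rightarrow> 'a graph \<Rightarrow> bool" where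
  "spanning_subgraph H G \<longleftrightarrow> verts H = verts G \<and> edges H \<subseteq> edges G"

text \<open>
  A copy of \<open>F\<close> in \<open>H\<close> is a not necessarily induced subgraph of \<open>H\<close> isomorphic to \<open>F\<close>,
  given here by an injective map that sends edges of \<open>F\<close> to edges of \<open>H\<close>.
\<close>

definition embeds_via :: "('b \<Rightarrow> 'a) \<Rightarrow> 'b graph \<Rightarrow> 'a graph \<Rightarrow> bool" where
  "embeds_via \<phi> F H \<longleftrightarrow>
     inj_on \<phi> (verts F) \<and> \<phi> ` verts F \<subseteq> verts H \<and> (\<forall>e\<in>edges F. \<phi> ` e \<in> edges H)"

definition contains_copy :: "'b graph \<Rightarrow> 'a graph \<Rightarrow> bool" where
  "contains_copy F H \<longleftrightarrow> (\<exists>\<phi>. embeds_via \<phi> F H)"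

definition edge_in_copy :: "'b graph \<Rightarrow> 'a graph \<Rightarrow> 'a set \<Rightarrow> bool" where
  "edge_in_copy F H e \<longleftrightarrow> (\<exists>\<phi>. embeds_via \<phi> F H \<and> (\<exists>f\<in>edges F. e = \<phi> ` f))"

definition bootstrap_step :: "'b graph \<Rightarrow> 'a graph \<Rightarrow> 'a graph \<Rightarrow> bool" where
  "bootstrap_step F H H' \<longleftrightarrow>
     (\<exists>e\<in>all_pairs (verts H). e \<notin> edges H \<and> H' = (verts H, insert e (edges H)) \<and> edge_in_copy F H' e)"

definition bootstrap_process :: "'b graph \<Rightarrow> nat \<Rightarrow> (nat \<Rightarrow> 'a graph) \<Rightarrow> bool" where
  "bootstrap_process F m P \<longleftrightarrow> (\<forall>i\<in>{1..m}. bootstrap_step F (P (i - 1)) (P i))"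

definition weakly_saturated :: "'b graph \<Rightarrow> 'a graph \<Rightarrow> 'a graph \<Rightarrow> bool" where
  "weakly_saturated F G H \<longleftrightarrow>
     spanning_subgraph H G \<and> \<not> contains_copy F H \<and>
     (\<exists>m P. bootstrap_process F m P \<and> P 0 = H \<and> P m = G)"

definition wsat :: "'a graph \<Rightarrow> 'b graph \<Rightarrow> nat" where
  "wsat G F = (LEAST k. \<exists>H. weakly_saturated F G H \<and> card (edges H) = k)"

text \<open>
  Deleting edges that lie in copies of \<open>F\<close> until none is left produces a weakly saturated subgraph,
  so the minimum defining \<open>wsat G F\<close> is attained as soon as \<open>F\<close> has an edge.
\<close>

lemma weakly_saturated_exists:
  assumes "simple_graph G" "edges F \<noteq> {}"
  shows "\<exists>H. weakly_saturated F G H"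
proof -
  obtain f where f: "f \<in> edges F" using assms(2) by blast
  let ?R = "\<lambda>H. spanning_subgraph H G \<and> (\<exists>m P. bootstrap_process F m P \<and> P 0 = H \<and> P m = G)"
  have fin: "finite (edges G)"
    using assms(1) unfolding simple_graph_def all_pairs_def
    by (auto intro: finite_subset[of _ "Pow (verts G)"])
  have step: "?R H \<Longrightarrow> \<exists>H'. weakly_saturated F G H'" for H
  proof (induction "card (edges H)" arbitrary: H rule: less_induct)
    case less
    from less.prems have sub: "spanning_subgraph H G" ..
    from less.prems obtain m P where P: "bootstrap_process F m P" "P 0 = H" "P m = G" by blast
    show ?case
    proof (cases "contains_copy F H")
      case False
      with less.prems have "weakly_saturated F G H" unfolding weakly_saturated_def by simp
      then show ?thesis ..
    next
      case True
      then obtain \<phi> where \<phi>: "embeds_via \<phi> F H" unfolding contains_copy_def by blast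
      define e where "e = \<phi> ` f"
      define H' where "H' = (verts H, edges H - {e})"
      have e: "e \<in> edges H" using \<phi> f unfolding embeds_via_def e_def by blast
      have eG: "e \<in> all_pairs (verts H)"
        using e sub assms(1) unfolding spanning_subgraph_def simple_graph_def by auto
      have H: "H = (verts H', insert e (edges H'))"
        using e unfolding H'_def by (auto simp: prod_eq_iff)
      have copy: "edge_in_copy F H e" using \<phi> f unfolding edge_in_copy_def e_def by blast
      have "e \<in> all_pairs (verts H')" "e \<notin> edges H'" using eG by (simp_all add: H'_def)
      then have step: "bootstrap_step F H' H"
        unfolding bootstrap_step_def using H copy by blast
      define Q where "Q i = (case i of 0 \<Rightarrow> H' | Suc j \<Rightarrow> P j)" for i
      have Q_proc: "bootstrap_process F (Suc m) Q"
        unfolding bootstrap_process_def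
      proof
        fix i assume "i \<in> {1..Suc m}"
        then obtain j where j: "i = Suc j" "j \<le> m" by (cases i) auto
        show "bootstrap_step F (Q (i - 1)) (Q i)"
        proof (cases j)
          case 0
          then show ?thesis using step P(2) j by (simp add: Q_def)
        next
          case (Suc k)
          then have "j \<in> {1..m}" using j by auto
          then have "bootstrap_step F (P (j - 1)) (P j)"
            using P(1) unfolding bootstrap_process_def by blast
          then show ?thesis using Suc j by (simp add: Q_def)
        qed
      qed
      have Q: "Q 0 = H'" "Q (Suc m) = G" by (simp_all add: Q_def P(3))
      have sub': "spanning_subgraph H' G"
        using sub unfolding spanning_subgraph_def H'_def by auto
      have R: "?R H'"
        by (intro conjI exI[of _ "Suc m"] exI[of _ Q]) (use sub' Q_proc Q in simp_all)
      have "finite (edges H)" using sub fin unfolding spanning_subgraph_def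
        by (meson finite_subset)
      then have "card (edges H') < card (edges H)"
        using card_Diff1_less[OF _ e] by (simp only: H'_def snd_conv)
      then show ?thesis using R by (rule less.hyps)
    qed
  qed
  show ?thesis
    by (rule step[of G])
      (auto simp: spanning_subgraph_def bootstrap_process_def intro!: exI[of _ 0] exI[of _ "\<lambda>_. G"])
qed

lemma wsat_attained:
  assumes "simple_graph G" "edges F \<noteq> {}"
  shows "\<exists>H. weakly_saturated F G H \<and> card (edges H) = wsat G F"
  unfolding wsat_def by (rule LeastI_ex) (use weakly_saturated_exists[OF assms] in blast)

text \<open>
  The Erdos--Renyi random graph: the coordinates of \<open>Pi_pmf\<close> are independent, one Bernoulli
  trial for each two-element subset of the vertex set.
\<close>

definition random_graph :: "nat \<Rightarrow> real \<Rightarrow> nat graph pmf" where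
  "random_graph n p =
     map_pmf (\<lambda>present. ({1..n}, {e \<in> all_pairs {1..n}. present e}))
       (Pi_pmf (all_pairs {1..n}) False (\<lambda>_. bernoulli_pmf p))"

end

theory Submission
  imports Defs
begin

text \<open>
  Write \<open>r = s - 2\<close>, \<open>L = ln n\<close>, and let \<open>A\<close> be a fixed set of order \<open>L\<^sup>2 / p\<^sup>r\<^sup>+\<^sup>1\<close> vertices (if that
  exceeds \<open>n\<close>, the edges of the whole graph already satisfy the bound). Take all edges inside \<open>A\<close>,
  about \<open>p |A|\<^sup>2\<close> of them by Markov's inequality, and join every further vertex \<open>v\<close> by \<open>r\<close> edges to an
  \<open>r\<close>-clique in \<open>A\<close>.
  Whp any \<open>r + 1\<close> vertices have a common neighbour in \<open>A\<close>, and the common neighbourhood in \<open>A\<close> of any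
  set of at most \<open>r\<close> vertices induces a connected graph: with \<open>k\<close> of order \<open>L / p\<close>, a small side
  (at most \<open>k\<close> vertices) of a cut is excluded by a union bound over that side only, and two \<open>k\<close>-sets
  without an edge between them do not occur at all. Connectivity lets an \<open>(r + 1)\<close>-clique through \<open>v\<close>
  whose edges at \<open>v\<close> are present spread until all edges from \<open>v\<close> to \<open>A\<close> are present; then each
  edge \<open>uv\<close> outside \<open>A\<close> is completed by an \<open>r\<close>-clique in the common neighbourhood of \<open>u\<close> and \<open>v\<close>.
\<close>

section \<open>Bootstrap percolation and cliques\<close>

lemma pair_in_all_pairs: "x \<in> V \<Longrightarrow> y \<in> V \<Longrightarrow> x \<noteq> y \<Longrightarrow> {x, y} \<in> all_pairs V"
  by (auto simp: all_pairs_def)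

lemma all_pairsE:
  assumes "e \<in> all_pairs V"
  obtains x y where "x \<in> V" "y \<in> V" "x \<noteq> y" "e = {x, y}"
  using assms by (auto simp: all_pairs_def card_2_iff)

lemma all_pairs_mono: "A \<subseteq> B \<Longrightarrow> all_pairs A \<subseteq> all_pairs B"
  by (auto simp: all_pairs_def)

lemma finite_all_pairs [simp]: "finite V \<Longrightarrow> finite (all_pairs V)"
  by (rule finite_subset[of _ "Pow V"]) (auto simp: all_pairs_def)

text \<open>The process half of \<open>weakly_saturated\<close>. Leaving out the absence of copies
  of \<open>F\<close> lets a percolating subgraph be built freely; \<open>wsat_le_card\<close>
  restores that requirement afterwards.\<close>

definition percolates :: "'b graph \<Rightarrow> 'a graph \<Rightarrow> 'a graph \<Rightarrow> bool" where
  "percolates F H G \<longleftrightarrow> (\<exists>m P. bootstrap_process F m P \<and> P 0 = H \<and> P m = G)"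

lemma percolates_refl: "percolates F G G"
  unfolding percolates_def bootstrap_process_def
  by (intro exI[of _ 0] exI[of _ "\<lambda>_. G"]) auto

lemma percolates_step:
  assumes "bootstrap_step F H' H" "percolates F H G"
  shows "percolates F H' G"
proof -
  from assms(2) obtain m P where P: "bootstrap_process F m P" "P 0 = H" "P m = G"
    unfolding percolates_def by blast
  define Q where "Q i = (case i of 0 \<Rightarrow> H' | Suc j \<Rightarrow> P j)" for i
  have "bootstrap_step F (Q (i - 1)) (Q i)" if "i \<in> {1..Suc m}" for i
  proof (cases "i = 1")
    case True
    then show ?thesis using assms(1) P(2) by (simp add: Q_def)
  next
    case False
    with that obtain j where j: "i = Suc (Suc j)" "Suc j \<in> {1..m}"
      by (cases i; cases "i - 1") auto
    then show ?thesis using P(1) unfolding bootstrap_process_def by (force simp: Q_def)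
  qed
  then show ?thesis
    unfolding percolates_def bootstrap_process_def
    by (intro exI[of _ "Suc m"] exI[of _ Q]) (simp add: Q_def P(3))
qed

text \<open>Copies of \<open>F\<close> in \<open>H\<close> are removed without losing percolation:
  deleting an edge of a copy lowers the edge count, and the first step of the new process puts it
  back. Repetition ends in a graph without copies that has no more edges than
  \<open>H\<close>.\<close>

lemma wsat_le_card:
  assumes "finite (edges G)" "edges G \<subseteq> all_pairs (verts G)" "edges F \<noteq> {}"
    and "spanning_subgraph H G" "percolates F H G"
  shows "wsat G F \<le> card (edges H)"
  using assms(4,5)
proof (induction "card (edges H)" arbitrary: H rule: less_induct)
  case less
  note H = less.prems
  show ?case
  proof (cases "contains_copy F H")
    case False
    with H have "weakly_saturated F G H"
      unfolding weakly_saturated_def percolates_def by simp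
    then show ?thesis unfolding wsat_def by (intro Least_le) blast
  next
    case True
    then obtain \<phi> f where \<phi>: "embeds_via \<phi> F H" and f: "f \<in> edges F"
      using assms(3) unfolding contains_copy_def by blast
    define e where "e = \<phi> ` f"
    define H' where "H' = (verts H, edges H - {e})"
    have e: "e \<in> edges H" using \<phi> f by (auto simp: embeds_via_def e_def)
    have fin: "finite (edges H)"
      using H(1) assms(1) by (auto simp: spanning_subgraph_def intro: finite_subset)
    have lt: "card (edges H') < card (edges H)"
      using card_Diff1_less[OF fin e] by (simp add: H'_def)
    have "H = (verts H', insert e (edges H'))"
      using e by (auto simp: H'_def prod_eq_iff)
    moreover have "e \<in> all_pairs (verts H')" "e \<notin> edges H'"
      using e H(1) assms(2) by (auto simp: H'_def spanning_subgraph_def)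
    moreover have "edge_in_copy F H e"
      using \<phi> f by (auto simp: edge_in_copy_def e_def)
    ultimately have "bootstrap_step F H' H" unfolding bootstrap_step_def by metis
    then have "percolates F H' G" using H(2) by (rule percolates_step)
    moreover have "spanning_subgraph H' G"
      using H(1) by (auto simp: spanning_subgraph_def H'_def)
    ultimately have "wsat G F \<le> card (edges H')" using lt less.hyps by blast
    with lt show ?thesis by simp
  qed
qed

text \<open>The stuck states of the clique process inside \<open>E\<close>: no edge of
  \<open>E\<close> outside \<open>D\<close> is the last missing pair of an \<open>s\<close>-set.
  Reasoning about stuck states avoids fixing an order in which edges are added.\<close>

definition completion_closed :: "nat \<Rightarrow> 'a set set \<Rightarrow> 'a set set \<Rightarrow> bool" where
  "completion_closed s E D \<longleftrightarrow>
     (\<forall>S e. card S = s \<longrightarrow> e \<in> all_pairs S \<longrightarrow> e \<in> E \<longrightarrow> all_pairs S - {e} \<subseteq> D \<longrightarrow> e \<in> D)"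

lemma completion_closedD:
  "completion_closed s E D \<Longrightarrow> card S = s \<Longrightarrow> e \<in> all_pairs S \<Longrightarrow> e \<in> E
    \<Longrightarrow> (\<And>f. f \<in> all_pairs S \<Longrightarrow> f \<noteq> e \<Longrightarrow> f \<in> D) \<Longrightarrow> e \<in> D"
  unfolding completion_closed_def by blast

lemma edge_in_clique_copy:
  assumes "finite S" "card S = s" "S \<subseteq> V" "all_pairs S \<subseteq> D" "e \<in> all_pairs S"
  shows "edge_in_copy (complete_simple_graph s) (V, D) e"
proof -
  obtain \<phi> where \<phi>: "bij_betw \<phi> {1..s} S"
    using assms(1,2) by (metis card_atLeastAtMost diff_Suc_1 finite_atLeastAtMost finite_same_card_bij)
  have inj: "inj_on \<phi> {1..s}" and im: "\<phi> ` {1..s} = S" using \<phi> by (auto simp: bij_betw_def)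
  have "\<phi> ` f \<in> all_pairs S" if "f \<in> all_pairs {1..s}" for f
    using that inj im unfolding all_pairs_def by (auto simp: card_image inj_on_subset)
  then have "embeds_via \<phi> (complete_simple_graph s) (V, D)"
    using inj im assms(3,4) by (auto simp: embeds_via_def complete_simple_graph_def)
  moreover obtain x y where xy: "x \<in> {1..s}" "y \<in> {1..s}" "x \<noteq> y" "e = \<phi> ` {x, y}"
  proof -
    obtain a b where "a \<in> S" "b \<in> S" "a \<noteq> b" "e = {a, b}" using assms(5) by (rule all_pairsE)
    then show ?thesis using that unfolding im[symmetric] by blast
  qed
  moreover have "{x, y} \<in> edges (complete_simple_graph s)"
    using xy by (simp add: complete_simple_graph_def pair_in_all_pairs)
  ultimately show ?thesis unfolding edge_in_copy_def by blast
qed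

text \<open>As long as \<open>D\<close> is not all of \<open>E\<close>, \<open>closure\<close> says
  that \<open>D\<close> is not stuck, and a violation of \<open>completion_closed\<close> is exactly
  an admissible bootstrap step. The induction is on the number of missing edges.\<close>

lemma percolates_if_closure:
  assumes "finite V" "E \<subseteq> all_pairs V" "s \<ge> 2"
    and closure: "\<And>D. E\<^sub>0 \<subseteq> D \<Longrightarrow> D \<subseteq> E \<Longrightarrow> completion_closed s E D \<Longrightarrow> E \<subseteq> D"
    and "E\<^sub>0 \<subseteq> D" "D \<subseteq> E"
  shows "percolates (complete_simple_graph s) (V, D) (V, E)"
  using assms(5,6)
proof (induction "card (E - D)" arbitrary: D rule: less_induct)
  case less
  have finE: "finite E" using assms(1,2) by (meson finite_all_pairs finite_subset)
  show ?case
  proof (cases "E \<subseteq> D")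
    case True
    then show ?thesis using less.prems by (simp add: percolates_refl subset_antisym)
  next
    case False
    then have "\<not> completion_closed s E D" using closure less.prems by blast
    then obtain S e where S: "card S = s" "e \<in> all_pairs S" "e \<in> E" "all_pairs S - {e} \<subseteq> D" "e \<notin> D"
      unfolding completion_closed_def by blast
    have finS: "finite S" using S(1) assms(3) card_ge_0_finite by force
    have sub: "all_pairs S \<subseteq> insert e D" using S(4) by blast
    \<comment> \<open>\<open>completion_closed\<close> does not confine \<open>S\<close> to
      \<open>V\<close>, but each vertex of \<open>S\<close> lies in a pair of \<open>S\<close>, and
      all these pairs are edges of \<open>E\<close>.\<close>
    have "S \<subseteq> V"
    proof
      fix x assume x: "x \<in> S"
      then obtain y where "y \<in> S" "y \<noteq> x"
        using S(2) by (elim all_pairsE) metis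
      then have "{x, y} \<in> all_pairs V"
        using pair_in_all_pairs[of x S y] x sub S(3) less.prems(2) assms(2) by blast
      then show "x \<in> V" by (simp add: all_pairs_def)
    qed
    then have "edge_in_copy (complete_simple_graph s) (V, insert e D) e"
      using edge_in_clique_copy[OF finS S(1) _ sub S(2)] by blast
    then have "bootstrap_step (complete_simple_graph s) (V, D) (V, insert e D)"
      unfolding bootstrap_step_def using S(3,5) assms(2) by auto
    moreover have "card (E - insert e D) < card (E - D)"
      by (rule psubset_card_mono) (use finE S in auto)
    then have "percolates (complete_simple_graph s) (V, insert e D) (V, E)"
      using less.hyps[of "insert e D"] less.prems S(3) by blast
    ultimately show ?thesis by (rule percolates_step)
  qed
qed

section \<open>Percolation from a core\<close>

text \<open>The deterministic properties that hold whp. \<open>expand\<close> serves twice: a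
  singleton \<open>U\<close> yields common neighbours in \<open>A\<close> of up to
  \<open>r + 1\<close> vertices, and a larger \<open>U\<close> yields an edge leaving
  \<open>U\<close> inside the common neighbourhood of \<open>T\<close>. \<open>mixing\<close>
  handles cuts with two large sides.\<close>

locale expanding_core =
  fixes V :: "'a set" and E :: "'a set set" and A :: "'a set" and r k :: nat
  assumes finite_V: "finite V" and E_sub: "E \<subseteq> all_pairs V" and A_sub: "A \<subseteq> V"
    and r_pos: "r \<ge> 1" and k_pos: "k \<ge> 1"
    and expand: "\<And>T U. T \<subseteq> V \<Longrightarrow> card T \<le> r \<Longrightarrow> U \<subseteq> V \<Longrightarrow> T \<inter> U = {} \<Longrightarrow> U \<noteq> {} \<Longrightarrow> card U \<le> k
        \<Longrightarrow> \<exists>x\<in>A - T - U. (\<forall>t\<in>T. {t, x} \<in> E) \<and> (\<exists>u\<in>U. {u, x} \<in> E)"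
    and mixing: "\<And>U W. U \<subseteq> A \<Longrightarrow> W \<subseteq> A \<Longrightarrow> U \<inter> W = {} \<Longrightarrow> card U = k \<Longrightarrow> card W = k
        \<Longrightarrow> \<exists>u\<in>U. \<exists>w\<in>W. {u, w} \<in> E"
begin

section \<open>Cliques and connectivity in common neighbourhoods\<close>

definition common_nbrs :: "'a set \<Rightarrow> 'a set" where
  "common_nbrs T = {x \<in> A. \<forall>t\<in>T. {t, x} \<in> E}"

lemma edge_neq: "{x, y} \<in> E \<Longrightarrow> x \<noteq> y"
  using E_sub by (auto simp: all_pairs_def)

lemma common_nbrs_disjoint: "common_nbrs T \<inter> T = {}"
  using edge_neq by (fastforce simp: common_nbrs_def)

lemma common_nbr_exists:
  assumes "T \<subseteq> V" "T \<noteq> {}" "card T \<le> r + 1"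
  obtains x where "x \<in> common_nbrs T"
proof -
  obtain u where u: "u \<in> T" using assms(2) by blast
  have "finite T" using assms(1) finite_V by (rule finite_subset)
  then have "card (T - {u}) \<le> r" using u assms(3) by simp
  then obtain x where "x \<in> A" "\<forall>t\<in>T - {u}. {t, x} \<in> E" "{u, x} \<in> E"
    using expand[of "T - {u}" "{u}"] assms(1) u k_pos by auto
  then show ?thesis using that[of x] u by (auto simp: common_nbrs_def)
qed

text \<open>Greedy growth: a clique with at most \<open>r + 1\<close> vertices has a common
  neighbour in \<open>A\<close>, which can be appended. Hence size \<open>r + 2\<close> is reachable
  using new vertices of \<open>A\<close> only.\<close>

lemma clique_extend:
  assumes "K \<subseteq> V" "K \<noteq> {}" "all_pairs K \<subseteq> E" "card K \<le> q" "q \<le> r + 2"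
  shows "\<exists>K'. K \<subseteq> K' \<and> K' - K \<subseteq> A \<and> all_pairs K' \<subseteq> E \<and> card K' = q"
  using assms
proof (induction "q - card K" arbitrary: K)
  case 0
  then show ?case by auto
next
  case (Suc d)
  then have "card K \<le> r + 1" by linarith
  then obtain x where x: "x \<in> common_nbrs K" using common_nbr_exists[of K] Suc.prems by blast
  have fin: "finite K" using Suc.prems(1) finite_V by (rule finite_subset)
  have xA: "x \<in> A" and xK: "x \<notin> K" using x common_nbrs_disjoint[of K] by (auto simp: common_nbrs_def)
  have pairs: "all_pairs (insert x K) \<subseteq> E"
  proof
    fix e assume "e \<in> all_pairs (insert x K)"
    then obtain y z where e: "y \<in> insert x K" "z \<in> insert x K" "y \<noteq> z" "e = {y, z}"
      by (rule all_pairsE)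
    show "e \<in> E"
    proof (cases "y = x \<or> z = x")
      case True
      then show ?thesis using e x by (auto simp: common_nbrs_def insert_commute)
    next
      case False
      then show ?thesis using e Suc.prems(3) pair_in_all_pairs[of y K z] by auto
    qed
  qed
  have card: "card (insert x K) = Suc (card K)" using fin xK by simp
  have "d = q - card (insert x K)" "card (insert x K) \<le> q" using Suc.hyps(2) card by linarith+
  moreover have "insert x K \<subseteq> V" using Suc.prems(1) xA A_sub by blast
  ultimately obtain K' where "insert x K \<subseteq> K'" "K' - insert x K \<subseteq> A" "all_pairs K' \<subseteq> E" "card K' = q"
    using Suc.hyps(1)[of "insert x K"] Suc.prems(5) pairs by blast
  then show ?case using xA by (intro exI[of _ K']) auto
qed

text \<open>A cut of a common neighbourhood with a side of size at most \<open>k\<close> is crossed because of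
  \<open>expand\<close>; otherwise both sides contain \<open>k\<close>-sets, to which \<open>mixing\<close> applies.\<close>

lemma common_nbrs_connected:
  assumes T: "T \<subseteq> V" "card T \<le> r" and P: "P \<subseteq> common_nbrs T" "P \<noteq> {}"
    and closed: "\<And>y z. y \<in> P \<Longrightarrow> z \<in> common_nbrs T \<Longrightarrow> {y, z} \<in> E \<Longrightarrow> z \<in> P"
  shows "P = common_nbrs T"
proof (rule ccontr)
  assume "P \<noteq> common_nbrs T"
  define W where "W = common_nbrs T - P"
  have W: "W \<subseteq> common_nbrs T" "W \<noteq> {}" "P \<inter> W = {}" using P \<open>P \<noteq> common_nbrs T\<close> by (auto simp: W_def)
  have N: "common_nbrs T \<subseteq> A" by (auto simp: common_nbrs_def)
  have no_edge: "{y, z} \<notin> E" if "y \<in> P" "z \<in> W" for y z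
    using that closed by (auto simp: W_def)
  have large: "card U > k"
    if U: "U \<subseteq> common_nbrs T" "U \<noteq> {}" and out: "\<And>y z. y \<in> U \<Longrightarrow> z \<in> common_nbrs T - U \<Longrightarrow> {y, z} \<notin> E" for U
  proof (rule ccontr)
    assume "\<not> card U > k"
    moreover have "T \<inter> U = {}" using U(1) common_nbrs_disjoint[of T] by blast
    ultimately obtain x u where "x \<in> A - T - U" "\<forall>t\<in>T. {t, x} \<in> E" "u \<in> U" "{u, x} \<in> E"
      using expand[of T U] T U N A_sub by (meson not_le_imp_less subset_trans)
    then show False using out[of u x] by (auto simp: common_nbrs_def)
  qed
  have "card P > k" using large[of P] P no_edge by (auto simp: W_def)
  moreover have "card W > k"
  proof (rule large[OF W(1,2)])
    fix y z assume "y \<in> W" "z \<in> common_nbrs T - W"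
    then show "{y, z} \<notin> E" using no_edge[of z y] by (auto simp: W_def insert_commute)
  qed
  ultimately obtain P' W' where "P' \<subseteq> P" "card P' = k" "W' \<subseteq> W" "card W' = k"
    by (meson less_imp_le obtain_subset_with_card_n)
  then show False using mixing[of P' W'] no_edge P W N by blast
qed

section \<open>Completing the edges between a vertex and the core\<close>

context
  fixes D :: "'a set set"
  assumes closed: "completion_closed (r + 2) E D"
    and inner: "E \<inter> all_pairs A \<subseteq> D"
begin

text \<open>Downward induction on \<open>card T\<close>: by connectivity, the vertices \<open>y\<close> for which \<open>insert y T\<close>
  extends to a completed \<open>(r + 1)\<close>-clique exhaust the common neighbourhood of \<open>T\<close>.\<close>

lemma star_completion:
  assumes "v \<in> V"
    and "v \<in> T" "T - {v} \<subseteq> A" "T \<subseteq> K" "K - {v} \<subseteq> A" "all_pairs K \<subseteq> E" "card K = r + 1"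
    and "\<And>a. a \<in> K - {v} \<Longrightarrow> {v, a} \<in> D"
    and "x \<in> common_nbrs T"
  shows "{v, x} \<in> D"
  using assms(2-)
proof (induction "r + 1 - card T" arbitrary: T K x)
  case 0
  have finK: "finite K" using 0 card_ge_0_finite by force
  \<comment> \<open>The truncated subtraction being 0 means that \<open>card T\<close> is at least
    \<open>r + 1\<close>, the size of \<open>K\<close>.\<close>
  then have T: "T = K" using 0 by (metis card_seteq diff_is_0_eq)
  have xA: "x \<in> A" and xE: "\<And>t. t \<in> K \<Longrightarrow> {t, x} \<in> E" and xK: "x \<notin> K"
    using 0 T common_nbrs_disjoint[of T] by (auto simp: common_nbrs_def)
  have vx: "v \<noteq> x" "v \<in> K" using xK 0 by auto
  show ?case
  \<comment> \<open>In the clique \<open>insert x K\<close>, the other pairs at \<open>v\<close> are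
    in \<open>D\<close> by the assumption on \<open>K\<close>, and the pairs avoiding
    \<open>v\<close> are edges inside \<open>A\<close>. So only \<open>{v, x}\<close> can be
    missing.\<close>
  proof (rule completion_closedD[OF closed, of "insert x K"])
    show "card (insert x K) = r + 2" using 0 finK xK by simp
    show "{v, x} \<in> all_pairs (insert x K)" using vx by (intro pair_in_all_pairs) auto
    show "{v, x} \<in> E" using xE vx by blast
    fix f assume f: "f \<in> all_pairs (insert x K)" "f \<noteq> {v, x}"
    then obtain y z where yz: "y \<in> insert x K" "z \<in> insert x K" "y \<noteq> z" "f = {y, z}"
      by (elim all_pairsE)
    have fE: "{y, z} \<in> E"
    proof (cases "y \<in> K \<and> z \<in> K")
      case True
      then show ?thesis using yz "0.prems"(5) pair_in_all_pairs[of y K z] by blast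
    next
      case False
      then have "y = x \<and> z \<in> K \<or> z = x \<and> y \<in> K" using yz by blast
      then show ?thesis using xE[of y] xE[of z] by (metis insert_commute)
    qed
    consider "y = v" | "z = v" | "y \<noteq> v" "z \<noteq> v" by blast
    then show "f \<in> D"
    proof cases
      case 1
      then have "z \<in> K - {v}" using yz f by auto
      then show ?thesis using "0.prems"(7) 1 yz by blast
    next
      case 2
      then have "y \<in> K - {v}" using yz f by (auto simp: insert_commute)
      then show ?thesis using "0.prems"(7)[of y] 2 yz by (simp add: insert_commute)
    next
      case 3
      then have "y \<in> A" "z \<in> A" using yz xA "0.prems"(4) by auto
      then have "{y, z} \<in> E \<inter> all_pairs A" using fE yz(3) by (simp add: pair_in_all_pairs)
      then show ?thesis using inner yz(4) by auto
    qed
  qed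
next
  case (Suc d)
  note prems = Suc.prems
  have cT: "card T \<le> r" using Suc.hyps(2) by linarith
  have TV: "T \<subseteq> V" using prems(1,2) assms(1) A_sub by auto
  have finT: "finite T" using TV finite_V by (rule finite_subset)
  \<comment> \<open>\<open>good y\<close> provides exactly the clique that the induction hypothesis
    demands for \<open>insert y T\<close>; \<open>spread\<close> below is that application.\<close>
  define good where "good y \<longleftrightarrow> y \<in> common_nbrs T \<and>
    (\<exists>K. insert y T \<subseteq> K \<and> K - {v} \<subseteq> A \<and> all_pairs K \<subseteq> E \<and> card K = r + 1 \<and>
      (\<forall>a\<in>K - {v}. {v, a} \<in> D))" for y
  have in_pairs: "{a, b} \<in> E" if "all_pairs K \<subseteq> E" "a \<in> K" "b \<in> K" "a \<noteq> b" for a b K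
    using that(1) pair_in_all_pairs[OF that(2-4)] by (rule subsetD)
  have spread: "{v, z} \<in> D" if y: "good y" and z: "z \<in> common_nbrs (insert y T)" for y z
  proof -
    from y obtain K where K: "insert y T \<subseteq> K" "K - {v} \<subseteq> A" "all_pairs K \<subseteq> E" "card K = r + 1"
      "\<forall>a\<in>K - {v}. {v, a} \<in> D" unfolding good_def by blast
    have "y \<notin> T" using y common_nbrs_disjoint by (auto simp: good_def)
    then have "d = r + 1 - card (insert y T)" using Suc.hyps(2) finT by simp
    moreover have "y \<in> A" using y by (simp add: good_def common_nbrs_def)
    then have "insert y T - {v} \<subseteq> A" "v \<in> insert y T" using prems(1,2) by auto
    ultimately show ?thesis
      using Suc.hyps(1)[of "insert y T" K z] K z by blast
  qed
  \<comment> \<open>The given clique \<open>K\<close> has a vertex outside \<open>T\<close>, and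
    \<open>K\<close> itself witnesses that this vertex is good. This starts the spreading.\<close>
  have "card T < card K" using cT prems(6) by simp
  then obtain a where a: "a \<in> K" "a \<notin> T" using prems(3) finT
    by (metis card_mono not_le subsetI)
  have "a \<in> common_nbrs T"
    unfolding common_nbrs_def
  proof (intro CollectI conjI ballI)
    show "a \<in> A" using a prems(1,4) by auto
    show "{t, a} \<in> E" if "t \<in> T" for t
      using in_pairs[OF prems(5), of t a] that a prems(3) by blast
  qed
  then have "good a" unfolding good_def using prems(3-7) a(1) by (intro conjI exI[of _ K]) auto
  have "{y. good y} = common_nbrs T"
  proof (rule common_nbrs_connected[OF TV cT])
    show "{y. good y} \<subseteq> common_nbrs T" by (auto simp: good_def)
    show "{y. good y} \<noteq> {}" using \<open>good a\<close> by auto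
    fix y z assume y: "y \<in> {y. good y}" and z: "z \<in> common_nbrs T" and yz: "{y, z} \<in> E"
    have zy: "z \<in> common_nbrs (insert y T)" using z yz by (auto simp: common_nbrs_def)
    have vz: "{v, z} \<in> D" using spread y zy by blast
    have yN: "y \<in> common_nbrs T" using y by (simp add: good_def)
    have mem: "y \<in> A" "z \<in> A" "y \<notin> T" "z \<notin> T" "y \<noteq> z"
      using yN z edge_neq[OF yz] common_nbrs_disjoint[of T] by (auto simp: common_nbrs_def)
    have "\<forall>a\<in>T - {v}. {v, a} \<in> D" using prems by blast
    have TE: "all_pairs T \<subseteq> E" using all_pairs_mono[OF prems(3)] prems(5) by blast
    have yzT: "all_pairs (insert y (insert z T)) \<subseteq> E"
    proof
      fix e assume "e \<in> all_pairs (insert y (insert z T))"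
      then obtain b c where "b \<in> insert y (insert z T)" "c \<in> insert y (insert z T)" "b \<noteq> c" "e = {b, c}"
        by (elim all_pairsE)
      moreover have "{b, c} \<in> E" if "b \<in> T" "c \<in> T" "b \<noteq> c" for b c
        using in_pairs[OF TE that] .
      moreover have "{b, y} \<in> E" "{b, z} \<in> E" "{y, b} \<in> E" "{z, b} \<in> E" "{z, y} \<in> E" if "b \<in> T" for b
        using that yz yN z by (auto simp: common_nbrs_def insert_commute)
      moreover have "{z, y} \<in> E" using yz by (simp add: insert_commute)
      ultimately show "e \<in> E" using yz by (elim insertE) blast+
    qed
    \<comment> \<open>Goodness passes from \<open>y\<close> to its neighbour \<open>z\<close>. If
      \<open>card T = r\<close>, then \<open>insert z T\<close> already has \<open>r + 1\<close>
      vertices. Otherwise \<open>y\<close> fits in as well, and keeping it makes every further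
      vertex of the clique a common neighbour of \<open>insert y T\<close>, so that
      \<open>spread\<close> supplies its edge to \<open>v\<close>.\<close>
    have "\<exists>K. insert z T \<subseteq> K \<and> K - {v} \<subseteq> A \<and> all_pairs K \<subseteq> E \<and> card K = r + 1 \<and>
      (\<forall>a\<in>K - {v}. {v, a} \<in> D)"
    proof (cases "card T = r")
      case True
      then show ?thesis
        using mem finT prems(2) vz \<open>\<forall>a\<in>T - {v}. {v, a} \<in> D\<close>
          subset_trans[OF all_pairs_mono[of "insert z T" "insert y (insert z T)"] yzT]
        by (intro exI[of _ "insert z T"]) auto
    next
      case False
      then have "card (insert y (insert z T)) \<le> r + 1" using cT finT mem by simp
      then obtain K' where K': "insert y (insert z T) \<subseteq> K'" "K' - insert y (insert z T) \<subseteq> A"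
          "all_pairs K' \<subseteq> E" "card K' = r + 1"
        using clique_extend[of "insert y (insert z T)" "r + 1"] yzT TV mem A_sub by auto
      have "{v, b} \<in> D" if b: "b \<in> K' - {v}" for b
      proof (cases "b \<in> T \<or> b = y")
        case True
        then show ?thesis
          using y b \<open>\<forall>a\<in>T - {v}. {v, a} \<in> D\<close> by (auto simp: good_def)
      next
        case False
        then have "b \<in> common_nbrs (insert y T)"
          unfolding common_nbrs_def
        proof (intro CollectI conjI ballI)
          show "b \<in> A" using b K'(2) mem False by blast
          show "{t, b} \<in> E" if "t \<in> insert y T" for t
            using in_pairs[OF K'(3), of t b] that b K'(1) False by blast
        qed
        then show ?thesis using spread y by blast
      qed
      then show ?thesis using K' mem prems(2) by (intro exI[of _ K']) auto
    qed
    then show "z \<in> {y. good y}" using z by (simp add: good_def)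
  qed
  then have "good x" using prems(8) by blast
  moreover have "v \<noteq> x" using prems(1,8) common_nbrs_disjoint[of T] by blast
  ultimately show ?case by (auto simp: good_def)
qed

end

text \<open>The starting graph consists of the edges inside \<open>A\<close> and \<open>r\<close>
  edges from each \<open>v\<close> to a clique \<open>K v\<close>. A stuck set containing it has all
  edges that meet \<open>A\<close> by \<open>star_completion\<close>; any other edge is the last
  missing pair of an \<open>(r + 2)\<close>-clique whose remaining vertices lie in
  \<open>A\<close>.\<close>

lemma wsat_bound:
  "wsat (V, E) (complete_simple_graph (r + 2)) \<le> card (E \<inter> all_pairs A) + r * card V"
proof -
  have finE: "finite E" using finite_V E_sub by (meson finite_all_pairs finite_subset)
  have "\<exists>K. v \<in> K \<and> K - {v} \<subseteq> A \<and> all_pairs K \<subseteq> E \<and> card K = r + 1" if "v \<in> V" for v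
  proof -
    have "all_pairs {v} = {}" by (auto elim!: all_pairsE)
    then show ?thesis using clique_extend[of "{v}" "r + 1"] that by auto
  qed
  then obtain K where K: "\<And>v. v \<in> V \<Longrightarrow> v \<in> K v \<and> K v - {v} \<subseteq> A \<and> all_pairs (K v) \<subseteq> E \<and> card (K v) = r + 1"
    by metis
  define E\<^sub>0 where "E\<^sub>0 = E \<inter> all_pairs A \<union> (\<Union>v\<in>V. (\<lambda>a. {v, a}) ` (K v - {v}))"
  have finK: "finite (K v)" if "v \<in> V" for v using K[OF that] card_ge_0_finite by force
  have "E\<^sub>0 \<subseteq> E" using K pair_in_all_pairs by (fastforce simp: E\<^sub>0_def)
  have closure: "E \<subseteq> D" if D: "E\<^sub>0 \<subseteq> D" "D \<subseteq> E" "completion_closed (r + 2) E D" for D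
  proof -
    have inner: "E \<inter> all_pairs A \<subseteq> D" using D(1) by (auto simp: E\<^sub>0_def)
    have star: "{v, x} \<in> D" if v: "v \<in> V" "x \<in> A" "{v, x} \<in> E" for v x
      \<comment> \<open>For \<open>T = {v}\<close> the common neighbourhood is the whole
        neighbourhood of \<open>v\<close> in \<open>A\<close>.\<close>
      by (rule star_completion[OF D(3) inner v(1), of "{v}" "K v"])
        (use v K[OF v(1)] D(1) in \<open>auto simp: E\<^sub>0_def common_nbrs_def\<close>)
    show "E \<subseteq> D"
    proof
      fix e assume e: "e \<in> E"
      then obtain u v where uv: "u \<in> V" "v \<in> V" "u \<noteq> v" "e = {u, v}" using E_sub by (blast elim: all_pairsE)
      have "all_pairs {u, v} \<subseteq> E" using e uv by (auto elim!: all_pairsE simp: insert_commute)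
      then obtain S where S: "{u, v} \<subseteq> S" "S - {u, v} \<subseteq> A" "all_pairs S \<subseteq> E" "card S = r + 2"
        using clique_extend[of "{u, v}" "r + 2"] uv by auto
      show "e \<in> D"
      proof (rule completion_closedD[OF D(3) S(4) _ e])
        show "e \<in> all_pairs S" using uv S by (auto intro: pair_in_all_pairs)
        fix f assume f: "f \<in> all_pairs S" "f \<noteq> e"
        then obtain x y where xy: "x \<in> S" "y \<in> S" "x \<noteq> y" "f = {x, y}" by (elim all_pairsE)
        have "x \<in> A \<or> y \<in> A" using xy f S uv by (auto simp: insert_commute)
        moreover have "x \<in> V" "y \<in> V" using xy S uv A_sub by auto
        ultimately show "f \<in> D" using star[of x y] star[of y x] f S xy by (auto simp: insert_commute)
      qed
    qed
  qed
  have "percolates (complete_simple_graph (r + 2)) (V, E\<^sub>0) (V, E)"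
    by (rule percolates_if_closure[OF finite_V E_sub _ closure]) (use \<open>E\<^sub>0 \<subseteq> E\<close> in auto)
  moreover have "{1, 2} \<in> edges (complete_simple_graph (r + 2))"
    by (auto simp: complete_simple_graph_def intro: pair_in_all_pairs)
  ultimately have "wsat (V, E) (complete_simple_graph (r + 2)) \<le> card E\<^sub>0"
    using wsat_le_card[of "(V, E)" "complete_simple_graph (r + 2)" "(V, E\<^sub>0)"] finE E_sub \<open>E\<^sub>0 \<subseteq> E\<close>
    by (fastforce simp: spanning_subgraph_def)
  also have "card E\<^sub>0 \<le> card (E \<inter> all_pairs A) + card (\<Union>v\<in>V. (\<lambda>a. {v, a}) ` (K v - {v}))"
    unfolding E\<^sub>0_def by (rule card_Un_le)
  also have "card (\<Union>v\<in>V. (\<lambda>a. {v, a}) ` (K v - {v})) \<le> (\<Sum>v\<in>V. card ((\<lambda>a. {v, a}) ` (K v - {v})))"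
    by (rule card_UN_le[OF finite_V])
  also have "\<dots> \<le> (\<Sum>v\<in>V. r)"
  proof (rule sum_mono)
    fix v assume "v \<in> V"
    then show "card ((\<lambda>a. {v, a}) ` (K v - {v})) \<le> r"
      using K[of v] finK[of v] card_image_le[of "K v - {v}" "\<lambda>a. {v, a}"] by simp
  qed
  finally show ?thesis by (simp add: mult.commute)
qed

end

section \<open>Families of independent Bernoulli trials\<close>

text \<open>The hypotheses on \<open>P\<close> and \<open>Q\<close> say that \<open>P\<close> reads
  only coordinates in \<open>B\<close> and \<open>Q\<close> only the others. Viewing the family as
  an independent pair of families over \<open>B\<close> and \<open>I - B\<close> turns the
  conjunction into a rectangle.\<close>

lemma Pi_pmf_prob_split:
  assumes "finite I" "B \<subseteq> I"
    and P: "\<And>f g. (\<And>i. i \<in> B \<Longrightarrow> f i = g i) \<Longrightarrow> P f = P g"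
    and Q: "\<And>f g. (\<And>i. i \<in> I - B \<Longrightarrow> f i = g i) \<Longrightarrow> Q f = Q g"
  shows "measure_pmf.prob (Pi_pmf I d p) {f. P f \<and> Q f} =
    measure_pmf.prob (Pi_pmf B d p) {f. P f} * measure_pmf.prob (Pi_pmf (I - B) d p) {f. Q f}"
proof -
  let ?h = "\<lambda>(f, g) i. if i \<in> B then f i else g i"
  let ?M = "Pi_pmf B d p" and ?N = "Pi_pmf (I - B) d p"
  have "finite B" using assms(1,2) finite_subset by blast
  then have "Pi_pmf I d p = map_pmf ?h (pair_pmf ?M ?N)"
    using Pi_pmf_union[of B "I - B" d p] assms(1,2) by (simp add: Un_absorb1)
  then have "measure_pmf.prob (Pi_pmf I d p) {f. P f \<and> Q f} =
      measure_pmf.prob (pair_pmf ?M ?N) (?h -` {f. P f \<and> Q f})" by simp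
  also have "?h -` {f. P f \<and> Q f} = {f. P f} \<times> {g. Q g}"
  proof -
    have "P (?h (f, g)) = P f" "Q (?h (f, g)) = Q g" for f g
      using P[of "?h (f, g)" f] Q[of "?h (f, g)" g] by auto
    then show ?thesis by (auto simp del: split_conv)
  qed
  \<comment> \<open>The sets of functions may be uncountable; intersecting them with the countable
    supports makes \<open>measure_pmf_prob_product\<close> applicable.\<close>
  also have "measure_pmf.prob (pair_pmf ?M ?N) ({f. P f} \<times> {g. Q g}) =
      measure_pmf.prob (pair_pmf ?M ?N) (({f. P f} \<inter> set_pmf ?M) \<times> ({g. Q g} \<inter> set_pmf ?N))"
    by (rule measure_pmf.finite_measure_eq_AE) (auto simp: AE_measure_pmf_iff)
  also have "\<dots> = measure_pmf.prob ?M ({f. P f} \<inter> set_pmf ?M) * measure_pmf.prob ?N ({g. Q g} \<inter> set_pmf ?N)"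
    by (rule measure_pmf_prob_product) auto
  finally show ?thesis by (simp add: measure_Int_set_pmf)
qed

lemma Pi_pmf_prob_local:
  assumes "finite I" "B \<subseteq> I"
    and P: "\<And>f g. (\<And>i. i \<in> B \<Longrightarrow> f i = g i) \<Longrightarrow> P f = P g"
  shows "measure_pmf.prob (Pi_pmf I d p) {f. P f} = measure_pmf.prob (Pi_pmf B d p) {f. P f}"
proof -
  have "measure_pmf.prob (Pi_pmf I d p) {f. P f \<and> True} =
    measure_pmf.prob (Pi_pmf B d p) {f. P f} * measure_pmf.prob (Pi_pmf (I - B) d p) {f. True}"
    by (rule Pi_pmf_prob_split[OF assms(1,2) P]) auto
  then show ?thesis by simp
qed

lemma Pi_pmf_prob_Int:
  assumes "finite I" "B \<subseteq> I"
    and P: "\<And>f g. (\<And>i. i \<in> B \<Longrightarrow> f i = g i) \<Longrightarrow> P f = P g"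
    and Q: "\<And>f g. (\<And>i. i \<in> I - B \<Longrightarrow> f i = g i) \<Longrightarrow> Q f = Q g"
  shows "measure_pmf.prob (Pi_pmf I d p) {f. P f \<and> Q f} =
    measure_pmf.prob (Pi_pmf I d p) {f. P f} * measure_pmf.prob (Pi_pmf I d p) {f. Q f}"
proof -
  have "measure_pmf.prob (Pi_pmf I d p) {f. P f} = measure_pmf.prob (Pi_pmf B d p) {f. P f}"
    by (rule Pi_pmf_prob_local[OF assms(1,2) P])
  moreover have "measure_pmf.prob (Pi_pmf I d p) {f. Q f} = measure_pmf.prob (Pi_pmf (I - B) d p) {f. Q f}"
    by (rule Pi_pmf_prob_local[OF assms(1) Diff_subset Q])
  moreover have "measure_pmf.prob (Pi_pmf I d p) {f. P f \<and> Q f} =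
    measure_pmf.prob (Pi_pmf B d p) {f. P f} * measure_pmf.prob (Pi_pmf (I - B) d p) {f. Q f}"
    by (rule Pi_pmf_prob_split[OF assms])
  ultimately show ?thesis by simp
qed

text \<open>Mutual independence of events that read pairwise disjoint blocks: one block is split off
  at a time, since the remaining events read only coordinates outside it.\<close>

lemma Pi_pmf_prob_blocks:
  fixes Q :: "'c \<Rightarrow> ('a \<Rightarrow> 'b) \<Rightarrow> bool"
  assumes "finite I" "finite X" "\<And>x. x \<in> X \<Longrightarrow> B x \<subseteq> I" "disjoint_family_on B X"
    and "\<And>x f g. x \<in> X \<Longrightarrow> (\<And>i. i \<in> B x \<Longrightarrow> f i = g i) \<Longrightarrow> Q x f = Q x g"
  shows "measure_pmf.prob (Pi_pmf I d p) {f. \<forall>x\<in>X. Q x f} =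
    (\<Prod>x\<in>X. measure_pmf.prob (Pi_pmf I d p) {f. Q x f})"
  using assms(2-)
proof (induction X rule: finite_induct)
  case empty
  then show ?case by simp
next
  case (insert x X)
  have split: "measure_pmf.prob (Pi_pmf I d p) {f. Q x f \<and> (\<forall>y\<in>X. Q y f)} =
    measure_pmf.prob (Pi_pmf I d p) {f. Q x f} * measure_pmf.prob (Pi_pmf I d p) {f. \<forall>y\<in>X. Q y f}"
  proof (rule Pi_pmf_prob_Int[OF assms(1), of "B x"])
    show "B x \<subseteq> I" using insert.prems by blast
    show "Q x f = Q x g" if "\<And>i. i \<in> B x \<Longrightarrow> f i = g i" for f g :: "'a \<Rightarrow> 'b"
      using insert.prems(3)[of x f g] that by blast
    fix f g :: "'a \<Rightarrow> 'b" assume fg: "\<And>i. i \<in> I - B x \<Longrightarrow> f i = g i"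
    have "Q y f = Q y g" if y: "y \<in> X" for y
    proof (rule insert.prems(3))
      show "y \<in> insert x X" using y by simp
      fix i assume i: "i \<in> B y"
      have "B x \<inter> B y = {}"
        using insert.prems(2) insert.hyps(2) y by (auto simp: disjoint_family_on_def)
      then show "f i = g i" using fg[of i] i insert.prems(1)[of y] y by blast
    qed
    then show "(\<forall>y\<in>X. Q y f) = (\<forall>y\<in>X. Q y g)" by blast
  qed
  have "disjoint_family_on B X"
    using insert.prems(2) by (auto simp: disjoint_family_on_def)
  moreover have "Q y f = Q y g" if "y \<in> X" "\<And>i. i \<in> B y \<Longrightarrow> f i = g i" for y and f g :: "'a \<Rightarrow> 'b"
    using insert.prems(3)[of y f g] that by blast
  ultimately have "measure_pmf.prob (Pi_pmf I d p) {f. \<forall>y\<in>X. Q y f} =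
      (\<Prod>y\<in>X. measure_pmf.prob (Pi_pmf I d p) {f. Q y f})"
    using insert.IH insert.prems(1) by blast
  with split show ?case by (simp add: insert.hyps)
qed

abbreviation bernoulli_family :: "'a set \<Rightarrow> real \<Rightarrow> ('a \<Rightarrow> bool) pmf" where
  "bernoulli_family I p \<equiv> Pi_pmf I False (\<lambda>_. bernoulli_pmf p)"

lemma bernoulli_family_single:
  assumes "finite I" "e \<in> I" "0 \<le> p" "p \<le> 1"
  shows "measure_pmf.prob (bernoulli_family I p) {f. f e} = p"
    and "measure_pmf.prob (bernoulli_family I p) {f. \<not> f e} = 1 - p"
proof -
  have map: "map_pmf (\<lambda>f. f e) (bernoulli_family I p) = bernoulli_pmf p"
    using assms by (simp add: Pi_pmf_component)
  have "measure_pmf.prob (map_pmf (\<lambda>f. f e) (bernoulli_family I p)) {True} = p"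
    unfolding map using assms by (simp add: measure_pmf_single)
  then show "measure_pmf.prob (bernoulli_family I p) {f. f e} = p" by (simp add: vimage_def)
  have "measure_pmf.prob (map_pmf (\<lambda>f. f e) (bernoulli_family I p)) {False} = 1 - p"
    unfolding map using assms by (simp add: measure_pmf_single)
  then show "measure_pmf.prob (bernoulli_family I p) {f. \<not> f e} = 1 - p" by (simp add: vimage_def)
qed

lemma bernoulli_family_all:
  assumes "finite I" "Y \<subseteq> I" "0 \<le> p" "p \<le> 1"
  shows "measure_pmf.prob (bernoulli_family I p) {f. \<forall>e\<in>Y. f e} = p ^ card Y"
    and "measure_pmf.prob (bernoulli_family I p) {f. \<forall>e\<in>Y. \<not> f e} = (1 - p) ^ card Y"
proof -
  have fin: "finite Y" using assms finite_subset by blast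
  have disj: "disjoint_family_on (\<lambda>e. {e}) Y" by (auto simp: disjoint_family_on_def)
  have "measure_pmf.prob (bernoulli_family I p) {f. \<forall>e\<in>Y. f e} =
      (\<Prod>e\<in>Y. measure_pmf.prob (bernoulli_family I p) {f. f e})"
    by (rule Pi_pmf_prob_blocks[OF assms(1) fin _ disj]) (use assms in auto)
  also have "\<dots> = (\<Prod>e\<in>Y. p)"
    by (intro prod.cong refl bernoulli_family_single) (use assms in auto)
  finally show "measure_pmf.prob (bernoulli_family I p) {f. \<forall>e\<in>Y. f e} = p ^ card Y" by simp
  have "measure_pmf.prob (bernoulli_family I p) {f. \<forall>e\<in>Y. \<not> f e} =
      (\<Prod>e\<in>Y. measure_pmf.prob (bernoulli_family I p) {f. \<not> f e})"
    by (rule Pi_pmf_prob_blocks[OF assms(1) fin _ disj]) (use assms in auto)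
  also have "\<dots> = (\<Prod>e\<in>Y. 1 - p)"
    by (intro prod.cong refl bernoulli_family_single) (use assms in auto)
  finally show "measure_pmf.prob (bernoulli_family I p) {f. \<forall>e\<in>Y. \<not> f e} = (1 - p) ^ card Y" by simp
qed

lemma bernoulli_family_all_some:
  assumes "finite I" "Y \<subseteq> I" "Z \<subseteq> I" "Y \<inter> Z = {}" "0 \<le> p" "p \<le> 1"
  shows "measure_pmf.prob (bernoulli_family I p) {f. \<not> ((\<forall>e\<in>Y. f e) \<and> (\<exists>e\<in>Z. f e))}
    = 1 - p ^ card Y * (1 - (1 - p) ^ card Z)"
proof -
  let ?M = "bernoulli_family I p"
  have some: "measure_pmf.prob ?M {f. \<exists>e\<in>Z. f e} = 1 - (1 - p) ^ card Z"
  proof -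
    have "{f. \<exists>e\<in>Z. f e} = space ?M - {f. \<forall>e\<in>Z. \<not> f e}" by auto
    then show ?thesis
      using measure_pmf.prob_compl[of "{f. \<forall>e\<in>Z. \<not> f e}" ?M]
        bernoulli_family_all(2)[OF assms(1,3,5,6)] by simp
  qed
  have "measure_pmf.prob ?M {f. (\<forall>e\<in>Y. f e) \<and> (\<exists>e\<in>Z. f e)} =
    measure_pmf.prob ?M {f. \<forall>e\<in>Y. f e} * measure_pmf.prob ?M {f. \<exists>e\<in>Z. f e}"
  proof (rule Pi_pmf_prob_Int[OF assms(1,2)])
    fix f g :: "'a \<Rightarrow> bool" assume "\<And>i. i \<in> I - Y \<Longrightarrow> f i = g i"
    then show "(\<exists>e\<in>Z. f e) = (\<exists>e\<in>Z. g e)" using assms(3,4) by (metis DiffI IntI empty_iff subsetD)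
  qed auto
  moreover have "{f. \<not> ((\<forall>e\<in>Y. f e) \<and> (\<exists>e\<in>Z. f e))} = space ?M - {f. (\<forall>e\<in>Y. f e) \<and> (\<exists>e\<in>Z. f e)}"
    by auto
  ultimately show ?thesis
    using measure_pmf.prob_compl[of "{f. (\<forall>e\<in>Y. f e) \<and> (\<exists>e\<in>Z. f e)}" ?M]
      bernoulli_family_all(1)[OF assms(1,2,5,6)] some by simp
qed

section \<open>Probability bounds for fixed vertex sets\<close>

lemma one_minus_le_exp: "1 - x \<le> exp (- x)" for x :: real
  using exp_ge_add_one_self[of "- x"] by simp

text \<open>Distinct vertices \<open>x\<close> of \<open>X\<close> read disjoint sets of pairs, so
  their failures are independent. Each has probability \<open>1 - ?q\<close>, where
  \<open>?q\<close> is the chance that \<open>x\<close> sees all of \<open>T\<close> and some vertex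
  of \<open>U\<close>.\<close>

lemma prob_no_expansion:
  fixes p :: real
  assumes "finite V" "T \<subseteq> V" "U \<subseteq> V" "X \<subseteq> V" "T \<inter> U = {}" "X \<inter> (T \<union> U) = {}" "0 \<le> p" "p \<le> 1"
  shows "measure_pmf.prob (bernoulli_family (all_pairs V) p)
      {f. \<not> (\<exists>x\<in>X. (\<forall>t\<in>T. f {t, x}) \<and> (\<exists>u\<in>U. f {u, x}))}
    \<le> exp (- (card X * (p ^ card T * (1 - (1 - p) ^ card U))))"
proof -
  let ?M = "bernoulli_family (all_pairs V) p" and ?q = "p ^ card T * (1 - (1 - p) ^ card U)"
  let ?Q = "\<lambda>x f. \<not> ((\<forall>t\<in>T. f {t, x}) \<and> (\<exists>u\<in>U. f {u, x}))"
  have finI: "finite (all_pairs V)" using assms(1) by simp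
  have finX: "finite X" using assms(1,4) finite_subset by blast
  have "measure_pmf.prob ?M {f. \<forall>x\<in>X. ?Q x f} = (\<Prod>x\<in>X. measure_pmf.prob ?M {f. ?Q x f})"
  proof (rule Pi_pmf_prob_blocks[OF finI finX, where B = "\<lambda>x. (\<lambda>t. {t, x}) ` (T \<union> U)"])
    show "(\<lambda>t. {t, x}) ` (T \<union> U) \<subseteq> all_pairs V" if "x \<in> X" for x
      using that assms(2-6) by (auto intro!: pair_in_all_pairs)
    show "disjoint_family_on (\<lambda>x. (\<lambda>t. {t, x}) ` (T \<union> U)) X"
      unfolding disjoint_family_on_def
    proof (intro ballI impI equals0I)
      fix x y e assume *: "x \<in> X" "y \<in> X" "x \<noteq> y"
        "e \<in> (\<lambda>t. {t, x}) ` (T \<union> U) \<inter> (\<lambda>t. {t, y}) ` (T \<union> U)"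
      then obtain t t' where "t \<in> T \<union> U" "t' \<in> T \<union> U" "{t, x} = {t', y}" by blast
      \<comment> \<open>With \<open>x\<close> and \<open>y\<close> distinct, equality of the two
        pairs forces \<open>t = y\<close>, but \<open>X\<close> is disjoint from \<open>T\<close>
        and \<open>U\<close>.\<close>
      then show False using * assms(6) by (auto simp: doubleton_eq_iff)
    qed
    fix x and f g :: "'a set \<Rightarrow> bool" assume "\<And>i. i \<in> (\<lambda>t. {t, x}) ` (T \<union> U) \<Longrightarrow> f i = g i"
    then have "f {t, x} = g {t, x}" if "t \<in> T \<union> U" for t using that by blast
    then show "?Q x f = ?Q x g" by auto
  qed
  also have "\<dots> = (\<Prod>x\<in>X. 1 - ?q)"
  proof (rule prod.cong[OF refl])
    fix x assume x: "x \<in> X"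
    have inj: "inj_on (\<lambda>t. {t, x}) S" for S by (auto simp: inj_on_def doubleton_eq_iff)
    have sub: "(\<lambda>t. {t, x}) ` T \<subseteq> all_pairs V" "(\<lambda>t. {t, x}) ` U \<subseteq> all_pairs V"
      using x assms(2-6) by (auto intro!: pair_in_all_pairs)
    have "(\<lambda>t. {t, x}) ` T \<inter> (\<lambda>t. {t, x}) ` U = {}"
      using assms(5) by (auto simp: doubleton_eq_iff)
    from bernoulli_family_all_some[OF finI sub this assms(7,8)]
    show "measure_pmf.prob ?M {f. ?Q x f} = 1 - ?q" by (simp add: card_image[OF inj])
  qed
  also have "\<dots> = (1 - ?q) ^ card X" by simp
  also have "\<dots> \<le> exp (- ?q) ^ card X"
  proof (rule power_mono[OF one_minus_le_exp])
    have "(1 - p) ^ card U \<le> 1" "p ^ card T \<le> 1" "0 \<le> (1 - p) ^ card U" "0 \<le> p ^ card T"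
      using assms(7,8) by (auto intro: power_le_one)
    then show "0 \<le> 1 - ?q" by (simp add: mult_le_one)
  qed
  also have "\<dots> = exp (- (card X * ?q))" by (simp flip: exp_of_nat_mult)
  finally show ?thesis by (simp add: Collect_ball_eq ball_simps)
qed

lemma prob_no_edge_between:
  assumes "finite V" "U \<subseteq> V" "W \<subseteq> V" "U \<inter> W = {}" "0 \<le> p" "p \<le> 1"
  shows "measure_pmf.prob (bernoulli_family (all_pairs V) p) {f. \<not> (\<exists>u\<in>U. \<exists>w\<in>W. f {u, w})}
    \<le> exp (- (p * card U * card W))"
proof -
  let ?Y = "(\<lambda>(u, w). {u, w}) ` (U \<times> W)"
  have sub: "?Y \<subseteq> all_pairs V" using assms by (auto intro!: pair_in_all_pairs)
  have "inj_on (\<lambda>(u, w). {u, w}) (U \<times> W)"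
    using assms(4) by (auto simp: inj_on_def doubleton_eq_iff)
  then have card: "card ?Y = card U * card W" by (simp add: card_image card_cartesian_product)
  have "{f. \<not> (\<exists>u\<in>U. \<exists>w\<in>W. f {u, w})} = {f. \<forall>e\<in>?Y. \<not> f e}" by auto
  then have "measure_pmf.prob (bernoulli_family (all_pairs V) p) {f. \<not> (\<exists>u\<in>U. \<exists>w\<in>W. f {u, w})}
      = (1 - p) ^ (card U * card W)"
    using bernoulli_family_all(2)[OF _ sub, of p] assms card by simp
  also have "\<dots> \<le> exp (- p) ^ (card U * card W)"
    using assms by (intro power_mono one_minus_le_exp) auto
  also have "\<dots> = exp (- (p * card U * card W))" by (simp add: mult_ac flip: exp_of_nat_mult)
  finally show ?thesis .
qed

text \<open>Markov's inequality for a sum of indicators. No sharper concentration is called for,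
  because the diverging factor \<open>w n\<close> in the final bound absorbs the loss.\<close>

lemma prob_many_edges:
  assumes "finite I" "Y \<subseteq> I" "0 \<le> p" "p \<le> 1" "c > 0"
  shows "measure_pmf.prob (bernoulli_family I p) {f. real (card {e \<in> Y. f e}) \<ge> c} \<le> p * card Y / c"
proof -
  let ?M = "bernoulli_family I p"
  have fin: "finite Y" using assms(1,2) finite_subset by blast
  have int: "integrable ?M (\<lambda>f. indicator {f. f e} f :: real)" for e
    by (intro measure_pmf.integrable_const_bound[where B = 1]) (auto simp: indicator_def)
  have card: "real (card {e \<in> Y. f e}) = (\<Sum>e\<in>Y. indicator {f. f e} f)" for f
    using fin by (simp add: indicator_def sum.If_cases Int_def)
  have "measure_pmf.prob ?M {f \<in> space ?M. real (card {e \<in> Y. f e}) \<ge> c}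
      \<le> measure_pmf.expectation ?M (\<lambda>f. real (card {e \<in> Y. f e})) / c"
    by (rule integral_Markov_inequality_measure[where A = "{}"])
      (use assms in \<open>auto simp: card intro!: sum_nonneg Bochner_Integration.integrable_sum int\<close>)
  also have "measure_pmf.expectation ?M (\<lambda>f. real (card {e \<in> Y. f e})) = (\<Sum>e\<in>Y. measure_pmf.prob ?M {f. f e})"
    unfolding card by (subst Bochner_Integration.integral_sum) (auto intro: int)
  also have "\<dots> = (\<Sum>e\<in>Y. p)"
    by (intro sum.cong refl bernoulli_family_single) (use assms in auto)
  finally show ?thesis by (simp add: mult.commute)
qed

section \<open>The random graph\<close>

lemma card_subsets_le:
  assumes "finite V"
  shows "card {S. S \<subseteq> V \<and> card S = j} \<le> card V ^ j"
proof (cases "j \<le> card V")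
  case True
  then show ?thesis using n_subsets[OF assms, of j] binomial_le_pow[of j "card V"] by simp
next
  case False
  then have "{S. S \<subseteq> V \<and> card S = j} = {}" using card_mono[OF assms] by fastforce
  then show ?thesis by (simp only: card.empty)
qed

lemma finite_subsets_card: "finite V \<Longrightarrow> finite {S. S \<subseteq> V \<and> card S = j}"
  by (rule finite_subset[of _ "Pow V"]) auto

lemma prob_union_pairs_le:
  assumes "finite V" "\<And>T U. T \<subseteq> V \<Longrightarrow> card T = t \<Longrightarrow> U \<subseteq> V \<Longrightarrow> card U = i \<Longrightarrow> measure_pmf.prob M (B T U) \<le> b"
    and "b \<ge> 0"
  shows "measure_pmf.prob M (\<Union>T\<in>{S. S \<subseteq> V \<and> card S = t}. \<Union>U\<in>{S. S \<subseteq> V \<and> card S = i}. B T U)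
    \<le> real (card V) ^ (t + i) * b"
proof -
  let ?S = "\<lambda>j. {S. S \<subseteq> V \<and> card S = j}"
  note fin = finite_subsets_card[OF assms(1)]
  have "measure_pmf.prob M (\<Union>T\<in>?S t. \<Union>U\<in>?S i. B T U)
      \<le> (\<Sum>T\<in>?S t. measure_pmf.prob M (\<Union>U\<in>?S i. B T U))"
    by (intro measure_UNION_le fin) auto
  also have "\<dots> \<le> (\<Sum>T\<in>?S t. \<Sum>U\<in>?S i. measure_pmf.prob M (B T U))"
    by (intro sum_mono measure_UNION_le fin) auto
  also have "\<dots> \<le> (\<Sum>T\<in>?S t. \<Sum>U\<in>?S i. b)"
    by (intro sum_mono) (use assms(2) in auto)
  also have "\<dots> = real (card (?S t) * card (?S i)) * b" by simp
  also have "\<dots> \<le> real (card V ^ t * card V ^ i) * b"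
    using card_subsets_le[OF assms(1)] assms(3)
    by (intro mult_right_mono of_nat_mono mult_le_mono) auto
  finally show ?thesis by (simp add: power_add)
qed

text \<open>Follows from \<open>(1 - p) ^ i \<le> exp (- p * i)\<close> and
  \<open>exp y \<ge> 1 + y\<close>. As long as \<open>p * i\<close> is of order \<open>L\<close>,
  this gives a lower bound linear in \<open>i\<close>, which can beat the number of
  \<open>i\<close>-sets.\<close>

lemma one_minus_power_ge:
  fixes p :: real
  assumes "0 \<le> p" "p \<le> 1"
  shows "1 - (1 - p) ^ i \<ge> p * i / (1 + p * i)"
proof -
  have "(1 - p) ^ i \<le> exp (- p) ^ i" using assms by (intro power_mono one_minus_le_exp) auto
  also have "\<dots> = 1 / exp (p * i)" by (simp add: mult.commute exp_minus field_simps flip: exp_of_nat_mult)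
  also have "\<dots> \<le> 1 / (1 + p * i)"
    using assms by (intro divide_left_mono exp_ge_add_one_self mult_pos_pos) (auto simp: add_pos_nonneg)
  finally have "(1 - p) ^ i \<le> 1 / (1 + p * i)" .
  moreover have "1 - 1 / (1 + p * i) = p * i / (1 + p * i)"
  proof -
    have "0 \<le> p * i" using assms by simp
    then have "1 + p * i \<noteq> 0" by linarith
    then show ?thesis by (simp add: field_simps)
  qed
  ultimately show ?thesis by linarith
qed

text \<open>For \<open>card T = t\<close> and \<open>card U = i\<close> the failure probability is
  at most \<open>n\<close> to the power \<open>-(r + 3) * i\<close>, against at most
  \<open>n ^ (t + i)\<close> choices. Since \<open>t + i + 2 \<le> (r + 3) * i\<close>, each size
  pair contributes at most \<open>1 / n ^ 2\<close>, and there are \<open>(r + 1) * n\<close> size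
  pairs.\<close>

lemma prob_not_expanding:
  fixes n m r k :: nat and p L :: real
  defines "V \<equiv> {1..n}" and "A \<equiv> {1..m}" and "L \<equiv> ln n"
  assumes "n \<ge> 3" "m \<le> n" "0 < p" "p \<le> 1"
    and k: "p * k \<le> 3 * L + 1"
    and m: "(real m - r - k) * p ^ (r + 1) \<ge> (r + 3) * L * (3 * L + 2)"
  shows "measure_pmf.prob (bernoulli_family (all_pairs V) p)
    {f. \<exists>T U. T \<subseteq> V \<and> card T \<le> r \<and> U \<subseteq> V \<and> T \<inter> U = {} \<and> U \<noteq> {} \<and> card U \<le> k \<and>
        \<not> (\<exists>x\<in>A - T - U. (\<forall>t\<in>T. f {t, x}) \<and> (\<exists>u\<in>U. f {u, x}))}
    \<le> (r + 1) / n"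
proof -
  let ?M = "bernoulli_family (all_pairs V) p" and ?S = "\<lambda>j. {S. S \<subseteq> V \<and> card S = j}"
  \<comment> \<open>Irrelevant pairs get the empty event, so that one bound holds for all pairs of
    given sizes.\<close>
  define B where "B T U = (if T \<inter> U = {} \<and> card U \<le> k
    then {f. \<not> (\<exists>x\<in>A - T - U. (\<forall>t\<in>T. f {t, x}) \<and> (\<exists>u\<in>U. f {u, x}))} else {})" for T U
  have finV: "finite V" and cV: "card V = n" and AV: "A \<subseteq> V" using assms(5) by (auto simp: V_def A_def)
  have L: "L > 0" using assms(4) by (simp add: L_def)
  have single: "measure_pmf.prob ?M (B T U) \<le> 1 / real n ^ ((r + 3) * i)"
    if T: "T \<subseteq> V" "card T = t" and U: "U \<subseteq> V" "card U = i" and t: "t \<le> r" for T U t i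
  proof (cases "T \<inter> U = {} \<and> i \<le> k")
    case False
    then show ?thesis using U(2) by (auto simp: B_def)
  next
    case True
    let ?X = "A - T - U"
    have fin: "finite T" "finite U" using T U finV finite_subset by blast+
    have "m \<le> card ?X + card T + card U"
    proof -
      have "card A \<le> card (?X \<union> T \<union> U)" using fin by (intro card_mono) (auto simp: A_def)
      also have "\<dots> \<le> card ?X + card T + card U"
        by (meson card_Un_le add_mono order_refl order_trans)
      finally show ?thesis by (simp add: A_def)
    qed
    then have X: "real (card ?X) \<ge> real m - r - k" using T(2) U(2) t True by linarith
    have pi: "p * i \<le> 3 * L + 1"
      using True assms(6) k by (meson le_trans mult_left_mono of_nat_mono less_imp_le order_trans)
    have "p * i / (3 * L + 2) \<le> p * i / (1 + p * i)"
      using pi assms(6) L by (intro divide_left_mono mult_pos_pos) (auto simp: add_pos_nonneg)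
    then have U_lb: "p * i / (3 * L + 2) \<le> 1 - (1 - p) ^ i"
      using one_minus_power_ge[of p i] assms(6,7) by linarith
    \<comment> \<open>The factor \<open>3 * L + 2\<close> in hypothesis \<open>m\<close> pays for
      the denominator in \<open>U_lb\<close>; the factor \<open>p ^ (r + 1)\<close> splits into
      \<open>p ^ r\<close> for \<open>T\<close> and \<open>p\<close> for \<open>U\<close>.\<close>
    have "(r + 3) * L * i = (r + 3) * L * (3 * L + 2) * (i / (3 * L + 2))"
      using L by (simp add: field_simps)
    also have "\<dots> \<le> (real m - r - k) * p ^ (r + 1) * (i / (3 * L + 2))"
      using m L by (intro mult_right_mono) auto
    also have "\<dots> = (real m - r - k) * (p ^ r * (p * i / (3 * L + 2)))"
      by (simp add: mult_ac)
    also have "\<dots> \<le> card ?X * (p ^ r * (p * i / (3 * L + 2)))"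
      using X L assms(6) by (intro mult_right_mono) auto
    also have "\<dots> \<le> card ?X * (p ^ t * (1 - (1 - p) ^ i))"
      using U_lb t assms(6,7) L by (intro mult_left_mono mult_mono power_decreasing) auto
    finally have exponent: "(r + 3) * L * i \<le> card ?X * (p ^ t * (1 - (1 - p) ^ i))" .
    have "measure_pmf.prob ?M (B T U) \<le> exp (- (card ?X * (p ^ t * (1 - (1 - p) ^ i))))"
      using prob_no_expansion[of V T U ?X p] finV T U AV True assms(6,7) by (auto simp: B_def)
    also have "\<dots> \<le> exp (- ((r + 3) * L * i))" using exponent by simp
    also have "(r + 3) * L * i = real ((r + 3) * i) * L" by (simp add: mult_ac)
    also have "exp (- (real ((r + 3) * i) * L)) = 1 / exp L ^ ((r + 3) * i)"
      unfolding exp_of_nat_mult[symmetric] by (simp only: exp_minus inverse_eq_divide)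
    finally show ?thesis using assms(4) by (simp add: L_def)
  qed
  have "measure_pmf.prob ?M (\<Union>T\<in>?S t. \<Union>U\<in>?S i. B T U) \<le> 1 / real n ^ 2"
    if "t \<le> r" "i \<ge> 1" for t i
  proof -
    have "measure_pmf.prob ?M (\<Union>T\<in>?S t. \<Union>U\<in>?S i. B T U) \<le> real n ^ (t + i) * (1 / real n ^ ((r + 3) * i))"
      using prob_union_pairs_le[OF finV, of t i ?M B "1 / real n ^ ((r + 3) * i)"] single that(1)
      unfolding cV by simp
    also have "\<dots> \<le> 1 / real n ^ 2"
    proof -
      have "(r + 2) * 1 \<le> (r + 2) * i" using that(2) by (intro mult_le_mono2)
      then have "t + i + 2 \<le> (r + 3) * i" using that(1) by (simp add: algebra_simps)
      then have "real n ^ (t + i + 2) \<le> real n ^ ((r + 3) * i)"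
        using assms(4) by (intro power_increasing) auto
      then have "real n ^ (t + i) * (real n)\<^sup>2 \<le> real n ^ ((r + 3) * i)"
        by (simp only: power_add)
      moreover have "real n ^ ((r + 3) * i) > 0" "(real n)\<^sup>2 > 0" using assms(4) by simp_all
      ultimately show ?thesis by (simp only: pos_le_divide_eq pos_divide_le_eq times_divide_eq_right
            times_divide_eq_left mult_1_right mult_1_left)
    qed
    finally show ?thesis .
  qed
  then have "(\<Sum>t\<le>r. \<Sum>i\<in>{1..n}. measure_pmf.prob ?M (\<Union>T\<in>?S t. \<Union>U\<in>?S i. B T U))
      \<le> (\<Sum>t\<le>r. \<Sum>i\<in>{1..n}. 1 / real n ^ 2)" by (intro sum_mono) auto
  also have "\<dots> = (r + 1) / n" using assms(4) by (simp add: power2_eq_square)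
  finally have total: "(\<Sum>t\<le>r. \<Sum>i\<in>{1..n}. measure_pmf.prob ?M (\<Union>T\<in>?S t. \<Union>U\<in>?S i. B T U)) \<le> (r + 1) / n" .
  have "measure_pmf.prob ?M
    {f. \<exists>T U. T \<subseteq> V \<and> card T \<le> r \<and> U \<subseteq> V \<and> T \<inter> U = {} \<and> U \<noteq> {} \<and> card U \<le> k \<and>
        \<not> (\<exists>x\<in>A - T - U. (\<forall>t\<in>T. f {t, x}) \<and> (\<exists>u\<in>U. f {u, x}))}
    \<le> measure_pmf.prob ?M (\<Union>t\<le>r. \<Union>i\<in>{1..n}. \<Union>T\<in>?S t. \<Union>U\<in>?S i. B T U)"
  proof (rule measure_pmf.finite_measure_mono)
    show "{f. \<exists>T U. T \<subseteq> V \<and> card T \<le> r \<and> U \<subseteq> V \<and> T \<inter> U = {} \<and> U \<noteq> {} \<and> card U \<le> k \<and>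
        \<not> (\<exists>x\<in>A - T - U. (\<forall>t\<in>T. f {t, x}) \<and> (\<exists>u\<in>U. f {u, x}))}
      \<subseteq> (\<Union>t\<le>r. \<Union>i\<in>{1..n}. \<Union>T\<in>?S t. \<Union>U\<in>?S i. B T U)"
    proof clarify
      fix f T U
      assume *: "T \<subseteq> V" "card T \<le> r" "U \<subseteq> V" "T \<inter> U = {}" "U \<noteq> {}" "card U \<le> k"
        "\<not> (\<exists>x\<in>A - T - U. (\<forall>t\<in>T. f {t, x}) \<and> (\<exists>u\<in>U. f {u, x}))"
      have "card U \<in> {1..n}"
        using * finV cV card_mono[OF finV *(3)] finite_subset[OF *(3) finV]
        by (simp add: Suc_le_eq card_gt_0_iff)
      moreover have "f \<in> B T U" using * by (simp add: B_def)
      ultimately show "f \<in> (\<Union>t\<le>r. \<Union>i\<in>{1..n}. \<Union>T\<in>?S t. \<Union>U\<in>?S i. B T U)"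
        using *(1-3) by blast
    qed
  qed simp
  also have "\<dots> \<le> (\<Sum>t\<le>r. measure_pmf.prob ?M (\<Union>i\<in>{1..n}. \<Union>T\<in>?S t. \<Union>U\<in>?S i. B T U))"
    by (intro measure_UNION_le) auto
  also have "\<dots> \<le> (\<Sum>t\<le>r. \<Sum>i\<in>{1..n}. measure_pmf.prob ?M (\<Union>T\<in>?S t. \<Union>U\<in>?S i. B T U))"
    by (intro sum_mono measure_UNION_le) auto
  finally show ?thesis using total by linarith
qed

text \<open>Two disjoint \<open>k\<close>-sets have no edge between them with probability at most
  \<open>exp (- p * k * k)\<close>, which is at most \<open>n\<close> to the power
  \<open>-3 * k\<close>. The \<open>n ^ (2 * k)\<close> choices leave
  \<open>1 / n ^ k\<close>.\<close>

lemma prob_not_mixing: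
  fixes n k :: nat and p :: real and A :: "nat set"
  defines "V \<equiv> {1..n}"
  assumes "n \<ge> 1" "A \<subseteq> V" "0 < p" "p \<le> 1" "k \<ge> 1" "p * k \<ge> 3 * ln n"
  shows "measure_pmf.prob (bernoulli_family (all_pairs V) p)
    {f. \<exists>U W. U \<subseteq> A \<and> W \<subseteq> A \<and> U \<inter> W = {} \<and> card U = k \<and> card W = k \<and>
        \<not> (\<exists>u\<in>U. \<exists>w\<in>W. f {u, w})} \<le> 1 / n"
proof -
  let ?M = "bernoulli_family (all_pairs V) p" and ?S = "\<lambda>j. {S. S \<subseteq> V \<and> card S = j}"
  define B where "B U W = (if U \<inter> W = {} then {f. \<not> (\<exists>u\<in>U. \<exists>w\<in>W. f {u, w})} else {})" for U W :: "nat set"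
  have finV: "finite V" and cV: "card V = n" by (auto simp: V_def)
  have single: "measure_pmf.prob ?M (B U W) \<le> 1 / real n ^ (3 * k)"
    if "U \<subseteq> V" "card U = k" "W \<subseteq> V" "card W = k" for U W
  proof (cases "U \<inter> W = {}")
    case True
    have "measure_pmf.prob ?M (B U W) \<le> exp (- (p * k * k))"
      using prob_no_edge_between[of V U W p] finV that True assms(4,5) by (simp add: B_def)
    also have "\<dots> \<le> exp (- (3 * ln n * k))" using assms(7) by (simp add: mult_right_mono)
    also have "\<dots> = exp (- (real (3 * k) * ln n))" by (simp add: mult_ac)
    also have "\<dots> = 1 / exp (ln n) ^ (3 * k)"
      unfolding exp_of_nat_mult[symmetric] by (simp only: exp_minus inverse_eq_divide)
    finally show ?thesis using assms(2) by simp
  qed (simp add: B_def)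
  have "measure_pmf.prob ?M
    {f. \<exists>U W. U \<subseteq> A \<and> W \<subseteq> A \<and> U \<inter> W = {} \<and> card U = k \<and> card W = k \<and>
        \<not> (\<exists>u\<in>U. \<exists>w\<in>W. f {u, w})} \<le> measure_pmf.prob ?M (\<Union>U\<in>?S k. \<Union>W\<in>?S k. B U W)"
  proof (rule measure_pmf.finite_measure_mono, rule subsetI)
    fix f
    assume "f \<in> {f. \<exists>U W. U \<subseteq> A \<and> W \<subseteq> A \<and> U \<inter> W = {} \<and> card U = k \<and> card W = k \<and>
        \<not> (\<exists>u\<in>U. \<exists>w\<in>W. f {u, w})}"
    then obtain U W where *: "U \<subseteq> A" "W \<subseteq> A" "U \<inter> W = {}" "card U = k" "card W = k"
      "\<not> (\<exists>u\<in>U. \<exists>w\<in>W. f {u, w})" by blast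
    have "f \<in> B U W" using *(3,6) by (simp add: B_def)
    moreover have "U \<in> ?S k" "W \<in> ?S k" using * assms(3) by auto
    ultimately show "f \<in> (\<Union>U\<in>?S k. \<Union>W\<in>?S k. B U W)" by blast
  qed simp
  also have "\<dots> \<le> real n ^ (k + k) * (1 / real n ^ (3 * k))"
    by (rule prob_union_pairs_le[OF finV, unfolded cV]) (use single in auto)
  also have "\<dots> = 1 / real n ^ k"
  proof -
    have "3 * k = (k + k) + k" by simp
    then have "real n ^ (3 * k) = real n ^ (k + k) * real n ^ k" by (simp only: power_add)
    then show ?thesis using assms(2) by simp
  qed
  also have "\<dots> \<le> 1 / real n ^ 1"
    using assms(2,6) by (intro divide_left_mono power_increasing mult_pos_pos) auto
  finally show ?thesis by simp
qed

text \<open>The terms of the error are \<open>(r + 1) / n\<close> for expansion,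
  \<open>1 / n\<close> for mixing and the Markov bound for the edges inside \<open>A\<close>. The
  mean number of these edges is at most \<open>p * N\<^sup>2\<close>, of order
  \<open>L ^ 4 / p ^ (2 * r + 1)\<close>.\<close>

lemma prob_wsat_large:
  fixes n r :: nat and p c L :: real
  defines "L \<equiv> ln n"
  assumes "n \<ge> 3" "r \<ge> 1" "0 < p" "p \<le> 1" "c > 0"
  shows "measure_pmf.prob (random_graph n p)
      {G. real (wsat G (complete_simple_graph (r + 2))) > r * n + c * L ^ 4 / p ^ (2 * r + 1)}
    \<le> (r + 2) / n + (6 * r + 20)\<^sup>2 / c"
proof -
  define V where "V = {1..n}"
  \<comment> \<open>\<open>k\<close> is as small as \<open>prob_not_mixing\<close> allows. In
    \<open>N\<close> the summand \<open>r + k\<close> compensates for the vertices of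
    \<open>A\<close> that \<open>T\<close> and \<open>U\<close> may occupy.\<close>
  define k where "k = nat \<lceil>3 * L / p\<rceil>"
  define N where "N = nat \<lceil>(r + 3) * L * (3 * L + 2) / p ^ (r + 1)\<rceil> + r + k"
  define m where "m = min n N"
  define A where "A = {1..m}"
  define b where "b = c * L ^ 4 / p ^ (2 * r + 1)"
  let ?M = "bernoulli_family (all_pairs V) p" and ?C = "6 * real r + 20"
  define E where "E f = {e \<in> all_pairs V. f e}" for f
  have L: "L \<ge> 1"
  proof -
    have "exp 1 \<le> real n" using e_less_272 assms(2) by linarith
    then show ?thesis unfolding L_def using assms(2) by (subst ln_ge_iff) auto
  qed
  have b: "b > 0" using L assms(4,6) by (simp add: b_def)
  have finV: "finite V" and cV: "card V = n" and AV: "A \<subseteq> V" by (auto simp: V_def A_def m_def)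
  have "3 * L / p > 0" using L assms(4) by simp
  then have k: "3 * L / p \<le> k" "real k \<le> 3 * L / p + 1" "k \<ge> 1" unfolding k_def by linarith+
  have pk: "p * k \<ge> 3 * L" "p * k \<le> 3 * L + 1"
  proof -
    show "p * k \<ge> 3 * L" using k(1) assms(4) by (simp add: field_simps)
    have "p * k \<le> p * (3 * L / p + 1)" using k(2) assms(4) by (intro mult_left_mono) auto
    also have "\<dots> \<le> 3 * L + 1" using assms(4,5) by (simp add: field_simps)
    finally show "p * k \<le> 3 * L + 1" .
  qed
  have N_lb: "(real N - r - k) * p ^ (r + 1) \<ge> (r + 3) * L * (3 * L + 2)"
  proof -
    have "real N - r - k \<ge> (r + 3) * L * (3 * L + 2) / p ^ (r + 1)" unfolding N_def by linarith
    then show ?thesis using assms(4) by (simp add: field_simps)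
  qed
  \<comment> \<open>The constant \<open>6 * r + 20\<close> adds \<open>5 * (r + 3)\<close> from the
    main term, \<open>3\<close> from \<open>k\<close> and \<open>r + 2\<close> from \<open>r\<close>
    and the two roundings; all are absorbed using \<open>L \<ge> 1\<close> and
    \<open>p \<le> 1\<close>.\<close>
  have N_ub: "real N \<le> ?C * L\<^sup>2 / p ^ (r + 1)"
  proof -
    let ?q = "p ^ (r + 1)"
    have q: "?q > 0" "?q \<le> 1" "?q \<le> p"
      using assms(4,5) power_decreasing[of 1 "r + 1" p] power_le_one[of p "r + 1"] by auto
    have LL: "1 \<le> L\<^sup>2" "L \<le> L\<^sup>2" using L by (simp_all add: one_le_power self_le_power)
    have "(r + 3) * L * (3 * L + 2) / ?q \<ge> 0" using L q by simp
    then have "real N \<le> (r + 3) * L * (3 * L + 2) / ?q + 1 + r + (3 * L / p + 1)"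
      using k(2) unfolding N_def by linarith
    also have "(r + 3) * L * (3 * L + 2) / ?q \<le> (r + 3) * (5 * L\<^sup>2) / ?q"
    proof -
      have "L * (3 * L + 2) \<le> 5 * L\<^sup>2" using LL by (simp add: algebra_simps power2_eq_square)
      then have "real (r + 3) * (L * (3 * L + 2)) \<le> real (r + 3) * (5 * L\<^sup>2)"
        by (intro mult_left_mono) auto
      then show ?thesis using q by (intro divide_right_mono) (auto simp: mult.assoc)
    qed
    also have "3 * L / p \<le> 3 * L\<^sup>2 / ?q" using LL q L by (intro frac_le) auto
    also have "(r + 3) * (5 * L\<^sup>2) / ?q + 1 + r + (3 * L\<^sup>2 / ?q + 1)
        = ((5 * r + 18) * L\<^sup>2) / ?q + (r + 2)" by (simp add: algebra_simps add_divide_distrib)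
    also have "real (r + 2) \<le> (r + 2) * L\<^sup>2 / ?q"
    proof -
      have "1 \<le> L\<^sup>2 / ?q" using LL q by (simp add: field_simps)
      then have "real (r + 2) * 1 \<le> real (r + 2) * (L\<^sup>2 / ?q)" by (intro mult_left_mono) auto
      then show ?thesis by simp
    qed
    also have "((5 * r + 18) * L\<^sup>2) / ?q + (r + 2) * L\<^sup>2 / ?q = ?C * L\<^sup>2 / ?q"
      by (simp add: algebra_simps flip: add_divide_distrib)
    finally show ?thesis by simp
  qed
  define Bad where "Bad = {f. real (card {e \<in> all_pairs A. f e}) \<ge> b}"
  have Bad: "measure_pmf.prob ?M Bad \<le> ?C\<^sup>2 / c"
  proof -
    have "real (card (all_pairs A)) \<le> real (card A ^ 2)"
      unfolding all_pairs_def using card_subsets_le[of A 2] by (intro of_nat_mono) (simp add: A_def)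
    also have "\<dots> \<le> (real N)\<^sup>2" by (simp add: A_def m_def)
    also have "\<dots> \<le> (?C * L\<^sup>2 / p ^ (r + 1))\<^sup>2" by (rule power_mono[OF N_ub]) simp
    finally have "p * card (all_pairs A) / b \<le> p * (?C * L\<^sup>2 / p ^ (r + 1))\<^sup>2 / b"
      using assms(4) b by (intro divide_right_mono mult_left_mono) auto
    also have "\<dots> = ?C\<^sup>2 / c"
    proof -
      have "p * (?C * L\<^sup>2 / p ^ (r + 1))\<^sup>2 = ?C\<^sup>2 * L ^ 4 / p ^ (2 * r + 1)"
      proof -
        have "(L\<^sup>2)\<^sup>2 = L ^ 4" "(p ^ (r + 1))\<^sup>2 = p * p ^ (2 * r + 1)"
          by (simp_all add: mult.commute flip: power_mult power_Suc)
        then show ?thesis using assms(4) by (simp only: power_divide power_mult_distrib) simp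
      qed
      then show ?thesis unfolding b_def using assms(4,6) L by simp
    qed
    finally show ?thesis
      using prob_many_edges[of "all_pairs V" "all_pairs A" p b] finV all_pairs_mono[OF AV] assms(4,5) b
      unfolding Bad_def by simp
  qed
  have E_sub: "E f \<subseteq> all_pairs V" for f by (auto simp: E_def)
  have E_A: "E f \<inter> all_pairs A = {e \<in> all_pairs A. f e}" for f
    using all_pairs_mono[OF AV] by (auto simp: E_def)
  have E_iff: "{x, y} \<in> E f \<longleftrightarrow> f {x, y}" if "x \<in> V" "y \<in> V" "x \<noteq> y" for x y f
    using that by (simp add: E_def pair_in_all_pairs)
  let ?G = "\<lambda>f. (V, E f)"
  have "measure_pmf.prob (random_graph n p)
      {G. real (wsat G (complete_simple_graph (r + 2))) > r * n + b}
    = measure_pmf.prob ?M {f. real (wsat (?G f) (complete_simple_graph (r + 2))) > r * n + b}"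
    by (simp add: random_graph_def V_def E_def vimage_def)
  also have "\<dots> \<le> (r + 2) / n + ?C\<^sup>2 / c"
  proof (cases "N \<le> n")
    case False
    \<comment> \<open>When the desired core does not fit, \<open>A\<close> is the whole vertex set.
      The graph percolates to itself, so the bound on the edges inside \<open>A\<close>
      suffices.\<close>
    then have "A = V" by (simp add: A_def V_def m_def)
    have "wsat (?G f) (complete_simple_graph (r + 2)) \<le> card (E f \<inter> all_pairs A)" for f
    proof -
      have "{1, 2} \<in> edges (complete_simple_graph (r + 2))"
        by (auto simp: complete_simple_graph_def intro: pair_in_all_pairs)
      then have "wsat (?G f) (complete_simple_graph (r + 2)) \<le> card (edges (?G f))"
        using E_sub[of f] finite_subset[OF E_sub finite_all_pairs[OF finV]]
        by (intro wsat_le_card percolates_refl) (auto simp: spanning_subgraph_def)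
      then show ?thesis using E_sub[of f] \<open>A = V\<close> by (simp add: Int_absorb2)
    qed
    then have "{f. real (wsat (?G f) (complete_simple_graph (r + 2))) > r * n + b} \<subseteq> Bad"
      unfolding Bad_def E_A by (smt (verit) Collect_mono of_nat_0_le_iff of_nat_mono mult_nonneg_nonneg)
    then have "measure_pmf.prob ?M {f. real (wsat (?G f) (complete_simple_graph (r + 2))) > r * n + b}
        \<le> measure_pmf.prob ?M Bad" by (intro measure_pmf.finite_measure_mono) auto
    moreover have "0 \<le> (r + 2) / n" by simp
    ultimately show ?thesis using Bad by linarith
  next
    case True
    then have "m = N" by (simp add: m_def)
    define Bad\<^sub>1 where "Bad\<^sub>1 = {f. \<exists>T U. T \<subseteq> V \<and> card T \<le> r \<and> U \<subseteq> V \<and> T \<inter> U = {} \<and> U \<noteq> {} \<and> card U \<le> k \<and>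
        \<not> (\<exists>x\<in>A - T - U. (\<forall>t\<in>T. f {t, x}) \<and> (\<exists>u\<in>U. f {u, x}))}"
    define Bad\<^sub>2 where "Bad\<^sub>2 = {f. \<exists>U W. U \<subseteq> A \<and> W \<subseteq> A \<and> U \<inter> W = {} \<and> card U = k \<and> card W = k \<and>
        \<not> (\<exists>u\<in>U. \<exists>w\<in>W. f {u, w})}"
    have Bad1: "measure_pmf.prob ?M Bad\<^sub>1 \<le> (r + 1) / n"
      unfolding Bad\<^sub>1_def V_def A_def
      by (rule prob_not_expanding)
        (use assms(2,4,5) pk N_lb True \<open>m = N\<close> in \<open>auto simp: L_def\<close>)
    have Bad2: "measure_pmf.prob ?M Bad\<^sub>2 \<le> 1 / n"
      unfolding Bad\<^sub>2_def V_def
      by (rule prob_not_mixing) (use assms(2,4,5) pk k AV in \<open>auto simp: L_def V_def\<close>)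
    have "{f. real (wsat (?G f) (complete_simple_graph (r + 2))) > r * n + b} \<subseteq> Bad\<^sub>1 \<union> Bad\<^sub>2 \<union> Bad"
    proof (rule subsetI, rule ccontr)
      fix f assume large: "f \<in> {f. real (wsat (?G f) (complete_simple_graph (r + 2))) > r * n + b}"
        and f: "f \<notin> Bad\<^sub>1 \<union> Bad\<^sub>2 \<union> Bad"
      interpret expanding_core V "E f" A r k
      proof
        fix T U assume *: "T \<subseteq> V" "card T \<le> r" "U \<subseteq> V" "T \<inter> U = {}" "U \<noteq> {}" "card U \<le> k"
        have "\<exists>x\<in>A - T - U. (\<forall>t\<in>T. f {t, x}) \<and> (\<exists>u\<in>U. f {u, x})"
        proof (rule ccontr)
          assume "\<not> ?thesis"
          then have "f \<in> Bad\<^sub>1" unfolding Bad\<^sub>1_def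
            by - (rule CollectI, rule exI[of _ T], rule exI[of _ U], use * in simp)
          with f show False by blast
        qed
        then obtain x u where x: "x \<in> A - T - U" "\<forall>t\<in>T. f {t, x}" "u \<in> U" "f {u, x}" by blast
        \<comment> \<open>Because \<open>x\<close> lies outside \<open>T\<close> and
          \<open>U\<close>, the sets \<open>{t, x}\<close> and \<open>{u, x}\<close> are genuine
          pairs, on which \<open>f\<close> and \<open>E f\<close> agree.\<close>
        then show "\<exists>x\<in>A - T - U. (\<forall>t\<in>T. {t, x} \<in> E f) \<and> (\<exists>u\<in>U. {u, x} \<in> E f)"
          using *(1,3) AV E_iff[of _ x f] by (intro bexI[of _ x]) blast+
      next
        fix U W assume *: "U \<subseteq> A" "W \<subseteq> A" "U \<inter> W = {}" "card U = k" "card W = k"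
        have "\<exists>u\<in>U. \<exists>w\<in>W. f {u, w}"
        proof (rule ccontr)
          assume "\<not> ?thesis"
          then have "f \<in> Bad\<^sub>2" unfolding Bad\<^sub>2_def
            by - (rule CollectI, rule exI[of _ U], rule exI[of _ W], use * in simp)
          with f show False by blast
        qed
        then obtain u w where "u \<in> U" "w \<in> W" "f {u, w}" by blast
        then show "\<exists>u\<in>U. \<exists>w\<in>W. {u, w} \<in> E f"
          using *(1-3) AV E_iff[of u w f] by blast
      qed (use finV E_sub AV assms(3) k in auto)
      have "real (wsat (?G f) (complete_simple_graph (r + 2))) \<le> real (card (E f \<inter> all_pairs A) + r * card V)"
        by (intro of_nat_mono wsat_bound)
      moreover have "real (card (E f \<inter> all_pairs A)) < b" using f unfolding Bad_def E_A by auto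
      ultimately show False using large cV by simp
    qed
    then have "measure_pmf.prob ?M {f. real (wsat (?G f) (complete_simple_graph (r + 2))) > r * n + b}
        \<le> measure_pmf.prob ?M (Bad\<^sub>1 \<union> Bad\<^sub>2 \<union> Bad)"
      by (intro measure_pmf.finite_measure_mono) auto
    also have "\<dots> \<le> measure_pmf.prob ?M Bad\<^sub>1 + measure_pmf.prob ?M Bad\<^sub>2 + measure_pmf.prob ?M Bad"
      using measure_Un_le[of "Bad\<^sub>1 \<union> Bad\<^sub>2" ?M Bad] measure_Un_le[of "Bad\<^sub>1" ?M "Bad\<^sub>2"] by simp
    also have "\<dots> \<le> (r + 1) / n + 1 / n + ?C\<^sup>2 / c" using Bad Bad1 Bad2 by linarith
    also have "\<dots> = (r + 2) / n + ?C\<^sup>2 / c" by (simp add: add_divide_distrib)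
    finally show ?thesis .
  qed
  finally show ?thesis by (simp add: b_def)
qed

text \<open>\<open>prob_wsat_large\<close> is applied with \<open>c = w n\<close>; both error terms
  then vanish because \<open>n\<close> and \<open>w n\<close> diverge.\<close>

theorem theorem5p1:
  fixes s \<gamma> :: nat and w p :: "nat \<Rightarrow> real"
  assumes "s \<ge> 3"
    and "\<gamma> = (if s = 3 then 1 else 0)"
    and "filterlim w at_top sequentially"
    and "\<And>n. n \<ge> 1 \<Longrightarrow> p n \<in> {0<..1}"
  shows "(\<lambda>n. measure_pmf.prob (random_graph n (p n))
            {G. real (wsat G (complete_simple_graph s))
                  \<le> (real s - 2) * real n
                    + w n * ln (real n) ^ (2 * (\<gamma> + s - 2)) / p n ^ (2 * s - 3)})
         \<longlonglongrightarrow> 1"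
proof -
  define r where "r = s - 2"
  have s: "s = r + 2" "r \<ge> 1" "2 * s - 3 = 2 * r + 1" using assms(1) by (auto simp: r_def)
  let ?err = "\<lambda>n. (r + 2) / real n + (6 * r + 20)\<^sup>2 / w n"
  let ?P = "\<lambda>n. measure_pmf.prob (random_graph n (p n))
            {G. real (wsat G (complete_simple_graph s))
                  \<le> (real s - 2) * real n
                    + w n * ln (real n) ^ (2 * (\<gamma> + s - 2)) / p n ^ (2 * s - 3)}"
  have lower: "\<forall>\<^sub>F n in sequentially. 1 - ?err n \<le> ?P n"
    using filterlim_at_top_dense[THEN iffD1, OF assms(3), rule_format, of 0]
      eventually_ge_at_top[of 3]
  proof eventually_elim
    case (elim n)
    let ?K = "complete_simple_graph s" and ?M = "random_graph n (p n)"
    let ?Q = "{G. real (wsat G ?K) > r * n + w n * ln n ^ 4 / p n ^ (2 * r + 1)}"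
    have p: "0 < p n" "p n \<le> 1" using assms(4)[of n] elim by auto
    have "exp 1 \<le> real n" using e_less_272 elim(2) by linarith
    then have "1 \<le> ln (real n)" using elim(2) by (subst ln_ge_iff) auto
    \<comment> \<open>The argument yields the exponent 4 for every \<open>s\<close>. For
      \<open>s = 3\<close> the summand \<open>\<gamma> = 1\<close> makes the stated exponent exactly
      4; for larger \<open>s\<close> it is at least 4, and \<open>ln n \<ge> 1\<close>.\<close>
    moreover have "4 \<le> 2 * (\<gamma> + s - 2)" using assms(1,2) by auto
    ultimately have "ln n ^ 4 \<le> ln (real n) ^ (2 * (\<gamma> + s - 2))" by (intro power_increasing)
    then have "w n * ln n ^ 4 / p n ^ (2 * r + 1) \<le> w n * ln (real n) ^ (2 * (\<gamma> + s - 2)) / p n ^ (2 * r + 1)"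
      using elim(1) p by (intro divide_right_mono mult_left_mono) auto
    then have "- ?Q \<subseteq> {G. real (wsat G ?K) \<le> (real s - 2) * real n
        + w n * ln (real n) ^ (2 * (\<gamma> + s - 2)) / p n ^ (2 * s - 3)}"
      unfolding s(3) by (auto simp: s(1))
    then have "measure_pmf.prob ?M (- ?Q) \<le> ?P n"
      by (intro measure_pmf.finite_measure_mono) auto
    moreover have "measure_pmf.prob ?M (- ?Q) = 1 - measure_pmf.prob ?M ?Q"
      using measure_pmf.prob_compl[of ?Q ?M] by (simp add: Compl_eq_Diff_UNIV)
    moreover have "measure_pmf.prob ?M ?Q \<le> ?err n"
      using prob_wsat_large[of n r "p n" "w n"] elim s(2) p unfolding s(1) by simp
    ultimately show "1 - ?err n \<le> ?P n" by linarith
  qed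
  have "(\<lambda>n. 1 - ?err n) \<longlonglongrightarrow> 1 - (0 + 0)"
    by (intro tendsto_intros real_tendsto_divide_at_top[OF tendsto_const] assms(3) filterlim_real_sequentially)
  then have "(\<lambda>n. 1 - ?err n) \<longlonglongrightarrow> 1" by simp
  from lower _ this tendsto_const show ?thesis by (rule tendsto_sandwich) simp
qed

end
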